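(* Let $\mathcal G(u_0)$ be the solution operator of the periodic Burgers equation $u_t+uu_x=\kappa u_{xx}$ with $u(\cdot,0)=u_0$, where $u_0\in\mathcal S(M_0,M_1)$ is piecewise linear. Then there exist a ReLU network $g^{\mathcal N}(\mathbf u_{0,m};\Theta)$ of size $|\Theta|=\mathcal O(m^2\ln(m))$ and a uniform constant $C=C(\kappa,M_0,M_1)$ such that for any $\mathbf x\in[-\pi,\pi)\times(0,\infty)$ there exists a set of parameters $\Theta_{\mathbf x}$ such that, for all such $u_0$, $$\big|\mathcal G(u_0)(\mathbf x)-g^{\mathcal N}(\mathbf u_{0,m};\Theta_{\mathbf x})\big|\le\big|\mathcal G(u_0)(\mathbf x)-\mathcal G_m(\mathbf u_{0,m};\mathbf x)\big|+\big|\mathcal G_m(\mathbf u_{0,m};\mathbf x)-g^{\mathcal N}(\mathbf u_{0,m};\Theta_{\mathbf x})\big|\le Ch.$$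
   Context: Let $\kappa,M_0,M_1>0$ and $$\mathcal S=\mathcal S(M_0,M_1)=\Big\{v\in W^{1,\infty}(-\pi,\pi):\ \|v\|_{L^\infty}\le M_0,\ \|\partial_xv\|_{L^\infty}\le M_1,\ \int_{-\pi}^\pi v(s)\,ds=0\Big\}.$$ On a mesh $-\pi=x_0<\dots<x_m=\pi$ with $h_j=x_j-x_{j-1}$, $\max_jh_j\le h$, the data is $2\pi$-periodic and piecewise linear: $u_0(x)=\sum_{j=0}^{m-1}u_{0,j}L_j(x)$, $u_{0,j}=u_0(x_j)$, $L_j$ the (periodic) piecewise linear nodal basis, and $\mathbf u_{0,m}=(u_{0,0},\dots,u_{0,m-1})^\top$. The equation is posed on $\mathbb R\times(0,\infty)$ with $u(x-\pi,t)=u(x+\pi,t)$. Let $v_0(x)=\exp\big(-\frac1{2\kappa}\int_{-\pi}^xu_0(s)\,ds\big)$, extended $2\pi$-periodically, and $\mathcal K(x,y,t)=\frac1{\sqrt{4\pi\kappa t}}\exp\big(-\frac{(x-y)^2}{4\kappa t}\big)$. Then for $\mathbf x=(x,t)$, $$\mathcal G(u_0)(\mathbf x)=-2\kappa\,\frac{\int_{\mathbb R}\partial_x\mathcal K(x,y,t)v_0(y)\,dy}{\int_{\mathbb R}\mathcal K(x,y,t)v_0(y)\,dy},\qquad\mathcal G_m(\mathbf u_{0,m};\mathbf x)=\frac{-2\kappa\int_{\mathbb R}\partial_x\mathcal K(x,y,t)(\mathcal I_m^1v_0)(y)\,dy}{\int_{\mathbb R}\mathcal K(x,y,t)(\mathcal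 I_m^0v_0)(y)\,dy},$$ where, on the periodically extended mesh, $\mathcal I_m^0$ is piecewise constant interpolation (value at the left endpoint on each $[x_{j-1},x_j)$) and $\mathcal I_m^1$ is piecewise linear interpolation. ReLU network: feed-forward network with activation $\max(0,\cdot)$. The size $|\Theta|$ is the total number of nonzero parameters (weights and biases). *)

theory Defs
  imports
    "HOL-Analysis.Analysis"
    "HOL-Probability.Essential_Supremum"
    "HOL-Library.Landau_Symbols"
    "Jordan_Normal_Form.Matrix"
begin

section \<open>The class of initial data\<close>

abbreviation period_measure :: "real measure" where
  "period_measure \<equiv> lebesgue_on {-pi<..<pi}"

definition Linf_norm :: "(real \<Rightarrow> real) \<Rightarrow> ereal" where
  "Linf_norm f = esssup period_measure (\<lambda>x. ereal \<bar>f x\<bar>)"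

definition Linf :: "(real \<Rightarrow> real) set" where
  "Linf = {f. f \<in> borel_measurable period_measure \<and> Linf_norm f < \<infinity>}"

definition test_function :: "(real \<Rightarrow> real) \<Rightarrow> bool" where
  "test_function \<phi> \<longleftrightarrow>
     (\<forall>x. \<phi> field_differentiable at x) \<and> continuous_on UNIV (deriv \<phi>) \<and>
     (\<exists>K. compact K \<and> K \<subseteq> {-pi<..<pi} \<and> (\<forall>x. x \<notin> K \<longrightarrow> \<phi> x = 0))"

text \<open>Weak derivatives on the interval \<open>(-\<pi>, \<pi>)\<close>, tested against continuously differentiable
  functions of compact support (as in Brezis's definition of one-dimensional Sobolev spaces).\<close>

definition weak_derivative :: "(real \<Rightarrow> real) \<Rightarrow> (real \<Rightarrow> real) \<Rightarrow> bool" where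
  "weak_derivative v g \<longleftrightarrow>
     (\<forall>\<phi>. test_function \<phi> \<longrightarrow>
        (LINT x|period_measure. v x * deriv \<phi> x) = - (LINT x|period_measure. g x * \<phi> x))"

definition W1inf :: "(real \<Rightarrow> real) set" where
  "W1inf = {v \<in> Linf. \<exists>g \<in> Linf. weak_derivative v g}"

text \<open>A weak derivative is unique up to null sets, so the bound on the derivative does not depend
  on the representative \<open>g\<close>.\<close>

definition data_class :: "real \<Rightarrow> real \<Rightarrow> (real \<Rightarrow> real) set" where
  "data_class M0 M1 =
     {v \<in> W1inf. Linf_norm v \<le> ereal M0 \<and>
        (\<exists>g \<in> Linf. weak_derivative v g \<and> Linf_norm g \<le> ereal M1) \<and>
        (LINT s|period_measure. v s) = 0}"

section \<open>Meshes and interpolation\<close>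

definition is_mesh :: "nat \<Rightarrow> (nat \<Rightarrow> real) \<Rightarrow> real \<Rightarrow> bool" where
  "is_mesh m x h \<longleftrightarrow> m \<ge> 1 \<and> x 0 = -pi \<and> x m = pi \<and>
     (\<forall>j\<in>{1..m}. x (j - 1) < x j \<and> x j - x (j - 1) \<le> h)"

definition ext_mesh :: "nat \<Rightarrow> (nat \<Rightarrow> real) \<Rightarrow> int \<Rightarrow> real" where
  "ext_mesh m x i = x (nat (i mod int m)) + 2 * pi * of_int (i div int m)"

definition cell :: "nat \<Rightarrow> (nat \<Rightarrow> real) \<Rightarrow> real \<Rightarrow> int" where
  "cell m x y = (THE i. ext_mesh m x i \<le> y \<and> y < ext_mesh m x (i + 1))"

text \<open>The continuous piecewise linear function with value \<open>c i\<close> at the node \<open>ext_mesh m x i\<close>.\<close>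

definition pl_function :: "nat \<Rightarrow> (nat \<Rightarrow> real) \<Rightarrow> (int \<Rightarrow> real) \<Rightarrow> real \<Rightarrow> real" where
  "pl_function m x c y =
     (let i = cell m x y; a = ext_mesh m x i; b = ext_mesh m x (i + 1)
      in c i + (c (i + 1) - c i) * (y - a) / (b - a))"

definition interp0 :: "nat \<Rightarrow> (nat \<Rightarrow> real) \<Rightarrow> (real \<Rightarrow> real) \<Rightarrow> real \<Rightarrow> real" where
  "interp0 m x f y = f (ext_mesh m x (cell m x y))"

definition interp1 :: "nat \<Rightarrow> (nat \<Rightarrow> real) \<Rightarrow> (real \<Rightarrow> real) \<Rightarrow> real \<Rightarrow> real" where
  "interp1 m x f = pl_function m x (\<lambda>i. f (ext_mesh m x i))"

definition hat :: "nat \<Rightarrow> (nat \<Rightarrow> real) \<Rightarrow> nat \<Rightarrow> real \<Rightarrow> real" where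
  "hat m x j = pl_function m x (\<lambda>i. if i mod int m = int j then 1 else 0)"

definition nodal_values :: "nat \<Rightarrow> (nat \<Rightarrow> real) \<Rightarrow> (real \<Rightarrow> real) \<Rightarrow> real Matrix.vec" where
  "nodal_values m x u0 = Matrix.vec m (\<lambda>j. u0 (x j))"

definition from_nodal_values :: "nat \<Rightarrow> (nat \<Rightarrow> real) \<Rightarrow> real Matrix.vec \<Rightarrow> real \<Rightarrow> real" where
  "from_nodal_values m x U y = (\<Sum>j<m. vec_index U j * hat m x j y)"

definition pl_data :: "real \<Rightarrow> real \<Rightarrow> nat \<Rightarrow> (nat \<Rightarrow> real) \<Rightarrow> (real \<Rightarrow> real) set" where
  "pl_data M0 M1 m x =
     {u0 \<in> data_class M0 M1. u0 = from_nodal_values m x (nodal_values m x u0)}"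

section \<open>The periodic Burgers equation and its solution operator\<close>

text \<open>Classical solutions for positive times. The initial value is attained as a limit from
  \<open>t > 0\<close>, since \<open>u\<close> need not be meaningful at \<open>t = 0\<close>.\<close>

definition burgers_solution ::
  "real \<Rightarrow> (real \<Rightarrow> real) \<Rightarrow> (real \<Rightarrow> real \<Rightarrow> real) \<Rightarrow> bool" where
  "burgers_solution \<kappa> u0 u \<longleftrightarrow>
     (\<exists>ut ux uxx.
        continuous_on (UNIV \<times> {0<..}) (\<lambda>(x, t). ut x t) \<and>
        continuous_on (UNIV \<times> {0<..}) (\<lambda>(x, t). ux x t) \<and>
        continuous_on (UNIV \<times> {0<..}) (\<lambda>(x, t). uxx x t) \<and>
        (\<forall>x t. t > 0 \<longrightarrow>
           ((\<lambda>s. u x s) has_real_derivative ut x t) (at t) \<and>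
           ((\<lambda>y. u y t) has_real_derivative ux x t) (at x) \<and>
           ((\<lambda>y. ux y t) has_real_derivative uxx x t) (at x) \<and>
           ut x t + u x t * ux x t = \<kappa> * uxx x t)) \<and>
     (\<forall>x t. t > 0 \<longrightarrow> u (x - pi) t = u (x + pi) t) \<and>
     (\<forall>x. ((\<lambda>(y, t). u y t) \<longlongrightarrow> u0 x) (at (x, 0) within UNIV \<times> {0<..}))"

definition wrap :: "real \<Rightarrow> real" where
  "wrap x = x - 2 * pi * of_int \<lfloor>(x + pi) / (2 * pi)\<rfloor>"

text \<open>\<open>wrap\<close> maps into \<open>[-\<pi>, \<pi>)\<close>, which makes the following the periodic extension.\<close>

definition v0 :: "real \<Rightarrow> (real \<Rightarrow> real) \<Rightarrow> real \<Rightarrow> real" where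
  "v0 \<kappa> u0 x = exp (- (1 / (2 * \<kappa>)) * (LINT s:{-pi..wrap x}|lborel. u0 s))"

definition heat_kernel :: "real \<Rightarrow> real \<Rightarrow> real \<Rightarrow> real \<Rightarrow> real" where
  "heat_kernel \<kappa> x y t = 1 / sqrt (4 * pi * \<kappa> * t) * exp (- ((x - y)\<^sup>2 / (4 * \<kappa> * t)))"

definition burgers_op :: "real \<Rightarrow> (real \<Rightarrow> real) \<Rightarrow> real \<Rightarrow> real \<Rightarrow> real" where
  "burgers_op \<kappa> u0 x t =
     - 2 * \<kappa> * (LINT y|lborel. deriv (\<lambda>z. heat_kernel \<kappa> z y t) x * v0 \<kappa> u0 y)
       / (LINT y|lborel. heat_kernel \<kappa> x y t * v0 \<kappa> u0 y)"

definition burgers_op_approx ::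
  "real \<Rightarrow> nat \<Rightarrow> (nat \<Rightarrow> real) \<Rightarrow> real Matrix.vec \<Rightarrow> real \<Rightarrow> real \<Rightarrow> real" where
  "burgers_op_approx \<kappa> m msh U x t =
     (let w = v0 \<kappa> (from_nodal_values m msh U)
      in - 2 * \<kappa> * (LINT y|lborel. deriv (\<lambda>z. heat_kernel \<kappa> z y t) x * interp1 m msh w y)
           / (LINT y|lborel. heat_kernel \<kappa> x y t * interp0 m msh w y))"

section \<open>ReLU networks\<close>

text \<open>A parameter set is the list of weight matrices and bias vectors, input layer first; the
  last layer is affine, i.e. not followed by the activation.\<close>

type_synonym params = "(real mat \<times> real Matrix.vec) list"

text \<open>\<open>ds\<close> lists the layer widths, from the input to the output dimension.\<close>

definition has_architecture :: "nat list \<Rightarrow> params \<Rightarrow> bool" where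
  "has_architecture ds \<Theta> \<longleftrightarrow> length ds = Suc (length \<Theta>) \<and>
     (\<forall>l<length \<Theta>. fst (\<Theta> ! l) \<in> carrier_mat (ds ! Suc l) (ds ! l) \<and>
                     snd (\<Theta> ! l) \<in> carrier_vec (ds ! Suc l))"

definition relu :: "real \<Rightarrow> real" where
  "relu z = max 0 z"

fun relu_net :: "params \<Rightarrow> real Matrix.vec \<Rightarrow> real Matrix.vec" where
  "relu_net [] z = z"
| "relu_net [(W, b)] z = W *\<^sub>v z + b"
| "relu_net ((W, b) # L # \<Theta>) z = relu_net (L # \<Theta>) (map_vec relu (W *\<^sub>v z + b))"

definition layer_size :: "real mat \<times> real Matrix.vec \<Rightarrow> nat" where
  "layer_size L =
     card {(i, j). i < dim_row (fst L) \<and> j < dim_col (fst L) \<and> fst L $$ (i, j) \<noteq> 0} +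
     card {i. i < dim_vec (snd L) \<and> vec_index (snd L) i \<noteq> 0}"

definition net_size :: "params \<Rightarrow> nat" where
  "net_size \<Theta> = (\<Sum>L\<leftarrow>\<Theta>. layer_size L)"

end

theory Submission
  imports Defs "HOL-Probability.Distributions"
begin

text \<open>
  With the Cole--Hopf potential \<open>v = v0 \<kappa> u0\<close>, the solution is the logarithmic derivative
  \<open>- 2 * \<kappa> * \<Phi>\<^sub>x / \<Phi>\<close> of the heat extension \<open>\<Phi>\<close> of \<open>v\<close>. Every derivative of \<open>\<Phi>\<close> is a combination
  of the Gaussian moments \<open>J\<^sub>k(x, s) = \<integral> (x - y)^k exp (- s (x - y)\<^sup>2) v(y) dy\<close> at \<open>s = 1 / (4 \<kappa> t)\<close>, a family
  that is closed under differentiation; hence Burgers' equation is an algebraic identity between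
  \<open>J\<^sub>0, \<dots>, J\<^sub>3\<close> (\<open>cole_hopf_burgers\<close>).

  Since \<open>v' = - u0 * v / (2 * \<kappa>)\<close>, integration by parts turns the solution into a quotient of two
  averages against the heat kernel, \<open>\<langle>u0 v\<rangle> / \<langle>v\<rangle>\<close>. An average is bounded by the supremum of its
  integrand, so all estimates are uniform in \<open>x\<close> and \<open>t\<close>, down to \<open>t = 0\<close>, and over all meshes:
  \<^item> Replacing \<open>u0 v\<close> and \<open>v\<close> by their piecewise constant interpolants costs \<open>O(h)\<close>, because both are
    Lipschitz (\<open>burgers_op_interp0_error\<close>).
  \<^item> The numerator of the discretised operator differs from that of the solution by the derivative
    of the average of \<open>v - interp1 m x v\<close>, and that function is Lipschitz with constant
    \<open>O(h)\<close> (\<open>burgers_op_approx_error\<close>).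

  The network therefore does not have to imitate the discretised operator, whose numerator has
  coefficients as large as the inverse of the smallest cell. It is enough to approximate
  \<open>R = (\<Sum>j<m. p j * V j * U j) / (\<Sum>j<m. p j * V j)\<close>, where \<open>U j\<close> are the nodal values, \<open>p\<close> are
  nonnegative weights of sum 1 that depend on \<open>(x, t)\<close>, and \<open>V j = exp (- S j)\<close> with \<open>S\<close> linear in \<open>U\<close>.
  Writing products and quotients through logarithms,
  \<open>R + 2 M0 = exp (ln (\<Sum>j<m. p j * exp (ln (U j + 2 M0) - S j)) - ln (\<Sum>j<m. p j * exp (- S j)))\<close>
  is an alternation of linear maps and scalar functions that are Lipschitz on the relevant
  intervals. Each of the four scalar steps is interpolated with \<open>m\<close> equal steps, at an error \<open>O(1/m)\<close>
  and with \<open>O(m)\<close> parameters for each of at most \<open>2 m\<close> components; the linear maps have \<open>O(m\<^sup>2)\<close> entries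
  (\<open>weighted_average_network\<close>). Since \<open>m\<close> cells of length at most \<open>h\<close> cover a period,
  \<open>1 / m \<le> h / (2 \<pi>)\<close>, so the total error is \<open>O(h)\<close> with \<open>O(m\<^sup>2)\<close> parameters.
\<close>

section \<open>Dominated convergence and Gaussian moments\<close>

text \<open>In a first countable space the limit along \<open>at a within S\<close> is determined by sequences, to which
  dominated convergence applies.\<close>

lemma tendsto_integral_dominated:
  fixes f :: "'b::first_countable_topology \<Rightarrow> 'a \<Rightarrow> real"
  assumes meas: "\<forall>\<^sub>F z in at a within S. f z \<in> borel_measurable M"
    and l: "l \<in> borel_measurable M" and g: "integrable M g"
    and lim: "\<And>y. y \<in> space M \<Longrightarrow> ((\<lambda>z. f z y) \<longlongrightarrow> l y) (at a within S)"
    and bound: "\<forall>\<^sub>F z in at a within S. \<forall>y\<in>space M. \<bar>f z y\<bar> \<le> g y"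
  shows "((\<lambda>z. \<integral>y. f z y \<partial>M) \<longlongrightarrow> (\<integral>y. l y \<partial>M)) (at a within S)"
  unfolding tendsto_at_iff_sequentially
proof (intro allI impI)
  fix X assume X: "\<forall>i. X i \<in> S - {a}" "X \<longlonglongrightarrow> a"
  have fl: "filterlim X (at a within S) sequentially"
    using X by (auto simp: filterlim_at)
  have "\<forall>\<^sub>F n in sequentially. f (X n) \<in> borel_measurable M \<and> (\<forall>y\<in>space M. \<bar>f (X n) y\<bar> \<le> g y)"
    using eventually_compose_filterlim[OF eventually_conj[OF meas bound] fl] .
  then obtain N where N: "\<And>n. n \<ge> N \<Longrightarrow> f (X n) \<in> borel_measurable M \<and> (\<forall>y\<in>space M. \<bar>f (X n) y\<bar> \<le> g y)"
    by (auto simp: eventually_sequentially)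
  have "(\<lambda>n. \<integral>y. f (X (n + N)) y \<partial>M) \<longlonglongrightarrow> (\<integral>y. l y \<partial>M)"
  proof (rule integral_dominated_convergence[where w = g])
    show "AE y in M. (\<lambda>n. f (X (n + N)) y) \<longlonglongrightarrow> l y"
      using filterlim_compose[OF lim fl] by (auto intro!: AE_I2 LIMSEQ_ignore_initial_segment)
  qed (use N l g in auto)
  then show "((\<lambda>z. \<integral>y. f z y \<partial>M) \<circ> X) \<longlonglongrightarrow> (\<integral>y. l y \<partial>M)"
    unfolding comp_def by (rule LIMSEQ_offset)
qed

text \<open>By the mean value theorem, a bound on the derivative of the integrand dominates its difference
  quotients.\<close>

lemma has_real_derivative_integral:
  fixes f f' :: "real \<Rightarrow> 'a \<Rightarrow> real"
  assumes r: "r > 0"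
    and int: "\<And>z. \<bar>z - x\<bar> < r \<Longrightarrow> integrable M (f z)"
    and der: "\<And>z y. \<lbrakk>\<bar>z - x\<bar> < r; y \<in> space M\<rbrakk> \<Longrightarrow> ((\<lambda>z. f z y) has_real_derivative f' z y) (at z)"
    and bound: "\<And>z y. \<lbrakk>\<bar>z - x\<bar> < r; y \<in> space M\<rbrakk> \<Longrightarrow> \<bar>f' z y\<bar> \<le> g y"
    and g: "integrable M g" and meas: "f' x \<in> borel_measurable M"
  shows "((\<lambda>z. \<integral>y. f z y \<partial>M) has_real_derivative (\<integral>y. f' x y \<partial>M)) (at x)"
proof -
  have near: "\<forall>\<^sub>F z in at x. \<bar>z - x\<bar> < r"
    using r by (auto simp: eventually_at dist_real_def intro!: exI[of _ r])
  have "((\<lambda>z. \<integral>y. (f z y - f x y) / (z - x) \<partial>M) \<longlongrightarrow> (\<integral>y. f' x y \<partial>M)) (at x)"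
  proof (rule tendsto_integral_dominated[OF _ meas g])
    show "\<forall>\<^sub>F z in at x. (\<lambda>y. (f z y - f x y) / (z - x)) \<in> borel_measurable M"
      using near by eventually_elim (use int r in \<open>auto intro!: borel_measurable_integrable\<close>)
    show "((\<lambda>z. (f z y - f x y) / (z - x)) \<longlongrightarrow> f' x y) (at x)" if "y \<in> space M" for y
      using der[of x y] r that by (simp add: has_field_derivative_iff)
    show "\<forall>\<^sub>F z in at x. \<forall>y\<in>space M. \<bar>(f z y - f x y) / (z - x)\<bar> \<le> g y"
      using near
    proof eventually_elim
      case (elim z)
      show ?case
      proof
        fix y assume y: "y \<in> space M"
        have "\<bar>f z y - f x y\<bar> \<le> g y * \<bar>z - x\<bar>"
        proof (rule field_differentiable_bound[of "{x - r<..<x + r}" "\<lambda>z. f z y" "\<lambda>z. f' z y", simplified])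
          fix w assume "x - r < w \<and> w < x + r"
          then have w: "\<bar>w - x\<bar> < r" by auto
          show "((\<lambda>z. f z y) has_real_derivative f' w y) (at w within {x - r<..<x + r})"
            using der[OF w y] by (rule has_field_derivative_at_within)
          show "\<bar>f' w y\<bar> \<le> g y" using bound[OF w y] .
        qed (use elim r in auto)
        moreover have "0 \<le> g y" using bound[of x y] r y by auto
        ultimately show "\<bar>(f z y - f x y) / (z - x)\<bar> \<le> g y"
          by (cases "z = x") (auto simp: abs_divide divide_le_eq)
      qed
    qed
  qed
  moreover have "\<forall>\<^sub>F z in at x. (\<integral>y. (f z y - f x y) / (z - x) \<partial>M) = ((\<integral>y. f z y \<partial>M) - (\<integral>y. f x y \<partial>M)) / (z - x)"
    using near by eventually_elim (use int r in auto)
  ultimately show ?thesis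
    unfolding has_field_derivative_iff using tendsto_cong by fast
qed

text \<open>Keeping the powers apart from the normalisation of the heat kernel gives a family that is closed
  under differentiation in both variables.\<close>

definition gauss_moment :: "nat \<Rightarrow> (real \<Rightarrow> real) \<Rightarrow> real \<Rightarrow> real \<Rightarrow> real" where
  "gauss_moment k v x s = (LINT y|lborel. (x - y) ^ k * exp (- s * (x - y)\<^sup>2) * v y)"

lemma integrable_gauss_abs_power:
  assumes "s > 0"
  shows "integrable lborel (\<lambda>y::real. \<bar>y - c\<bar> ^ k * exp (- s * (y - c)\<^sup>2))"
proof -
  define \<sigma> where "\<sigma> = sqrt (1 / (2 * s))"
  have \<sigma>: "\<sigma> > 0" "\<sigma>\<^sup>2 = 1 / (2 * s)" using assms by (auto simp: \<sigma>_def)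
  have "integrable lborel (\<lambda>y. sqrt (2 * pi * \<sigma>\<^sup>2) * (normal_density c \<sigma> y * \<bar>y - c\<bar> ^ k))"
    by (intro integrable_mult_right integrable_normal_moment_abs \<sigma>)
  also have "(\<lambda>y. sqrt (2 * pi * \<sigma>\<^sup>2) * (normal_density c \<sigma> y * \<bar>y - c\<bar> ^ k)) =
      (\<lambda>y::real. \<bar>y - c\<bar> ^ k * exp (- s * (y - c)\<^sup>2))"
    using assms \<sigma> by (auto simp: normal_density_def fun_eq_iff field_simps)
  finally show ?thesis .
qed

text \<open>For \<open>x\<close> within distance 1 of \<open>c\<close> and exponents at least \<open>s\<close>, the kernels
  \<open>(x - y) ^ k * exp (- s * (x - y)\<^sup>2)\<close> have a common integrable majorant: since
  \<open>(y - c)\<^sup>2 \<le> 2 * (x - y)\<^sup>2 + 2\<close>, recentring at \<open>c\<close> costs a constant factor and half of the exponent.\<close>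

definition gauss_dom :: "nat \<Rightarrow> real \<Rightarrow> real \<Rightarrow> real \<Rightarrow> real" where
  "gauss_dom k s c y = 2 ^ k * exp s * ((1 + \<bar>y - c\<bar> ^ k) * exp (- (s / 2) * (y - c)\<^sup>2))"

lemma integrable_gauss_dom: "s > 0 \<Longrightarrow> integrable lborel (gauss_dom k s c)"
proof -
  assume "s > 0"
  then have "integrable lborel (\<lambda>y::real. \<bar>y - c\<bar> ^ 0 * exp (- (s / 2) * (y - c)\<^sup>2) + \<bar>y - c\<bar> ^ k * exp (- (s / 2) * (y - c)\<^sup>2))"
    by (intro Bochner_Integration.integrable_add integrable_gauss_abs_power) auto
  then show ?thesis unfolding gauss_dom_def
    by (intro integrable_mult_right) (simp add: algebra_simps)
qed

lemma gauss_dom_bound: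
  assumes s: "s0 > 0" "s \<ge> s0" and x: "\<bar>x - c\<bar> \<le> 1"
  shows "\<bar>(x - y) ^ k * exp (- s * (x - y)\<^sup>2)\<bar> \<le> gauss_dom k s0 c y"
proof -
  have "(y - c)\<^sup>2 \<le> 2 * (x - y)\<^sup>2 + 2"
  proof -
    have "0 \<le> ((x - y) + (x - c))\<^sup>2" "(x - c)\<^sup>2 \<le> 1" using x by (auto simp: abs_square_le_1)
    then show ?thesis by (simp add: power2_eq_square algebra_simps)
  qed
  then have "s0 * ((y - c)\<^sup>2) \<le> s0 * (2 * (x - y)\<^sup>2 + 2)" using s by (intro mult_left_mono) auto
  moreover have "s0 * (x - y)\<^sup>2 \<le> s * (x - y)\<^sup>2" using s by (intro mult_right_mono) auto
  ultimately have "- s * (x - y)\<^sup>2 \<le> s0 + - (s0 / 2) * (y - c)\<^sup>2" by (simp add: algebra_simps)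
  then have e: "exp (- s * (x - y)\<^sup>2) \<le> exp s0 * exp (- (s0 / 2) * (y - c)\<^sup>2)"
    by (simp flip: exp_add)
  have "\<bar>x - y\<bar> ^ k \<le> (2 * max 1 \<bar>y - c\<bar>) ^ k" using x by (intro power_mono) (auto simp: max_def abs_if split: if_splits)
  also have "\<dots> \<le> 2 ^ k * (1 + \<bar>y - c\<bar> ^ k)"
    by (auto simp: power_mult_distrib max_def)
  finally have p: "\<bar>x - y\<bar> ^ k \<le> 2 ^ k * (1 + \<bar>y - c\<bar> ^ k)" .
  have "\<bar>(x - y) ^ k * exp (- s * (x - y)\<^sup>2)\<bar> = \<bar>x - y\<bar> ^ k * exp (- s * (x - y)\<^sup>2)"
    by (simp add: abs_mult power_abs)
  also have "\<dots> \<le> (2 ^ k * (1 + \<bar>y - c\<bar> ^ k)) * (exp s0 * exp (- (s0 / 2) * (y - c)\<^sup>2))"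
    by (intro mult_mono p e) auto
  finally show ?thesis by (simp add: gauss_dom_def mult_ac)
qed

text \<open>What makes every integral against a Gaussian times a polynomial converge.\<close>

locale bounded_data =
  fixes v :: "real \<Rightarrow> real" and B :: real
  assumes meas [measurable]: "v \<in> borel_measurable borel" and bounded: "\<And>y. \<bar>v y\<bar> \<le> B"
begin

lemma dom_bound:
  assumes s: "s0 > 0" "s \<ge> s0" and x: "\<bar>x - c\<bar> \<le> 1"
  shows "\<bar>(x - y) ^ k * exp (- s * (x - y)\<^sup>2) * v y\<bar> \<le> gauss_dom k s0 c y * B"
  using gauss_dom_bound[OF assms, of y k] bounded[of y] 
  by (simp only: abs_mult[of _ "v y"]) (intro mult_mono; auto)

lemma integrable_gauss_moment:
  assumes "s > 0"
  shows "integrable lborel (\<lambda>y. (x - y) ^ k * exp (- s * (x - y)\<^sup>2) * v y)"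
  by (rule Bochner_Integration.integrable_bound[OF integrable_mult_left[OF integrable_gauss_dom[OF assms, of k x], of B]])
    (use dom_bound[of s s x x _ k] assms in \<open>auto intro!: AE_I2 intro: order_trans[OF _ abs_ge_self]\<close>)

text \<open>The two terms come from the power and from the exponential. For \<open>k = 0\<close> the first vanishes, so the
  truncated subtraction in \<open>k - 1\<close> is harmless.\<close>

lemma gauss_moment_deriv_x:
  assumes "s > 0"
  shows "((\<lambda>z. gauss_moment k v z s) has_real_derivative
     (real k * gauss_moment (k - 1) v x s - 2 * s * gauss_moment (Suc k) v x s)) (at x)"
proof -
  define f' where "f' = (\<lambda>x y. real k * ((x - y) ^ (k - 1) * exp (- s * (x - y)\<^sup>2) * v y) - 2 * s * ((x - y) ^ Suc k * exp (- s * (x - y)\<^sup>2) * v y))"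
  have eq: "(\<integral>y. f' x y \<partial>lborel) = real k * gauss_moment (k - 1) v x s - 2 * s * gauss_moment (Suc k) v x s"
    unfolding f'_def gauss_moment_def
    by (subst Bochner_Integration.integral_diff)
      (simp_all only: integrable_mult_right integrable_gauss_moment[OF assms] integral_mult_right_zero)
  have "((\<lambda>z. \<integral>y. (z - y) ^ k * exp (- s * (z - y)\<^sup>2) * v y \<partial>lborel) has_real_derivative (\<integral>y. f' x y \<partial>lborel)) (at x)"
  proof (rule has_real_derivative_integral[where r = 1 and f' = f' and g = "\<lambda>y. real k * (gauss_dom (k-1) s x y * B) + 2 * s * (gauss_dom (Suc k) s x y * B)"])
    show "integrable lborel (\<lambda>y. (z - y) ^ k * exp (- s * (z - y)\<^sup>2) * v y)" for z
      by (rule integrable_gauss_moment[OF assms])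
    show "((\<lambda>z. (z - y) ^ k * exp (- s * (z - y)\<^sup>2) * v y) has_real_derivative f' z y) (at z)" for z y
      unfolding f'_def
      by (auto intro!: derivative_eq_intros simp: algebra_simps power2_eq_square)
    show "\<bar>f' z y\<bar> \<le> real k * (gauss_dom (k-1) s x y * B) + 2 * s * (gauss_dom (Suc k) s x y * B)" if "\<bar>z - x\<bar> < 1" for z y
    proof -
      have "\<bar>f' z y\<bar> \<le> \<bar>real k * ((z - y) ^ (k - 1) * exp (- s * (z - y)\<^sup>2) * v y)\<bar> + \<bar>2 * s * ((z - y) ^ Suc k * exp (- s * (z - y)\<^sup>2) * v y)\<bar>"
        unfolding f'_def by (rule abs_triangle_ineq4)
      also have "\<dots> = real k * \<bar>(z - y) ^ (k - 1) * exp (- s * (z - y)\<^sup>2) * v y\<bar> + 2 * s * \<bar>(z - y) ^ Suc k * exp (- s * (z - y)\<^sup>2) * v y\<bar>"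
        using assms by (simp add: abs_mult[of "real k"] abs_mult[of "2 * s"] del: power_Suc)
      also have "\<dots> \<le> real k * (gauss_dom (k-1) s x y * B) + 2 * s * (gauss_dom (Suc k) s x y * B)"
        using that assms by (intro add_mono mult_left_mono dom_bound) auto
      finally show ?thesis .
    qed
    show "integrable lborel (\<lambda>y. real k * (gauss_dom (k-1) s x y * B) + 2 * s * (gauss_dom (Suc k) s x y * B))"
      using assms by (intro Bochner_Integration.integrable_add integrable_mult_left integrable_mult_right integrable_gauss_dom)
    show "f' x \<in> borel_measurable lborel" unfolding f'_def by measurable
  qed auto
  then show ?thesis unfolding eq gauss_moment_def .
qed

lemma gauss_moment_deriv_s:
  assumes "s > 0"
  shows "((\<lambda>s. gauss_moment k v x s) has_real_derivative (- gauss_moment (k + 2) v x s)) (at s)"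
proof -
  have "((\<lambda>s. \<integral>y. (x - y) ^ k * exp (- s * (x - y)\<^sup>2) * v y \<partial>lborel) has_real_derivative 
     (\<integral>y. - ((x - y) ^ (k + 2) * exp (- s * (x - y)\<^sup>2) * v y) \<partial>lborel)) (at s)"
  proof (rule has_real_derivative_integral[where r = "s / 2" and f' = "\<lambda>s y. - ((x - y) ^ (k + 2) * exp (- s * (x - y)\<^sup>2) * v y)" and g = "\<lambda>y. gauss_dom (k + 2) (s / 2) x y * B"])
    show "integrable lborel (\<lambda>y. (x - y) ^ k * exp (- z * (x - y)\<^sup>2) * v y)" if "\<bar>z - s\<bar> < s / 2" for z
      using that assms by (intro integrable_gauss_moment) (auto simp: abs_if split: if_splits)
    show "((\<lambda>z. (x - y) ^ k * exp (- z * (x - y)\<^sup>2) * v y) has_real_derivative - ((x - y) ^ (k + 2) * exp (- z * (x - y)\<^sup>2) * v y)) (at z)" for z y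
      by (auto intro!: derivative_eq_intros simp: algebra_simps power2_eq_square)
    show "\<bar>- ((x - y) ^ (k + 2) * exp (- z * (x - y)\<^sup>2) * v y)\<bar> \<le> gauss_dom (k + 2) (s / 2) x y * B" if "\<bar>z - s\<bar> < s / 2" for z y
      unfolding abs_minus_cancel using that assms by (intro dom_bound) (auto simp: abs_if split: if_splits)
  qed (use assms in \<open>auto intro!: integrable_mult_left integrable_gauss_dom\<close>)
  then show ?thesis unfolding gauss_moment_def by simp
qed

lemma gauss_moment_continuous:
  "continuous_on (UNIV \<times> {0<..}) (\<lambda>(x, s). gauss_moment k v x s)"
  unfolding continuous_on_def
proof safe
  fix x s :: real assume s: "0 < s"
  have near: "\<forall>\<^sub>F z in at (x, s) within UNIV \<times> {0<..}. \<bar>fst z - x\<bar> \<le> 1 \<and> snd z \<ge> s / 2"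
  proof -
    have "\<forall>\<^sub>F z in at (x, s) within UNIV \<times> {0<..}. dist z (x, s) < min 1 (s / 2)"
      using s by (auto simp: eventually_at intro!: exI[of _ "min 1 (s / 2)"])
    then show ?thesis
    proof eventually_elim
      case (elim z)
      then show ?case using dist_fst_le[of z "(x,s)"] dist_snd_le[of z "(x,s)"]
        by (auto simp: dist_real_def abs_if split: if_splits)
    qed
  qed
  have "((\<lambda>z. \<integral>y. (fst z - y) ^ k * exp (- snd z * (fst z - y)\<^sup>2) * v y \<partial>lborel) \<longlongrightarrow>
     (\<integral>y. (x - y) ^ k * exp (- s * (x - y)\<^sup>2) * v y \<partial>lborel)) (at (x, s) within UNIV \<times> {0<..})"
  proof (rule tendsto_integral_dominated)
    show "((\<lambda>z. (fst z - y) ^ k * exp (- snd z * (fst z - y)\<^sup>2) * v y) \<longlongrightarrow> (x - y) ^ k * exp (- s * (x - y)\<^sup>2) * v y) (at (x, s) within UNIV \<times> {0<..})" for y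
      by (auto intro!: tendsto_eq_intros)
    show "integrable lborel (\<lambda>y. gauss_dom k (s / 2) x y * B)"
      using s by (intro integrable_mult_left integrable_gauss_dom) auto
    show "\<forall>\<^sub>F z in at (x, s) within UNIV \<times> {0<..}. \<forall>y\<in>space lborel. \<bar>(fst z - y) ^ k * exp (- snd z * (fst z - y)\<^sup>2) * v y\<bar> \<le> gauss_dom k (s / 2) x y * B"
      using near by eventually_elim (use s in \<open>intro ballI dom_bound; simp\<close>)
  qed auto
  then show "((\<lambda>(x, s). gauss_moment k v x s) \<longlongrightarrow> gauss_moment k v x s) (at (x, s) within UNIV \<times> {0<..})"
    by (simp add: gauss_moment_def case_prod_beta')
qed


lemma gauss_moment_continuous':
  assumes "\<kappa> > 0"
  shows "continuous_on (UNIV \<times> {0<..}) (\<lambda>z. gauss_moment k v (fst z) (1 / (4 * \<kappa> * snd z)))"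
proof -
  have "continuous_on (UNIV \<times> {0<..}) (\<lambda>z. (\<lambda>(x, s). gauss_moment k v x s) (fst z, 1 / (4 * \<kappa> * snd z)))"
    by (rule continuous_on_compose2[OF gauss_moment_continuous])
      (use assms in \<open>auto intro!: continuous_intros\<close>)
  then show ?thesis by simp
qed

text \<open>Here \<open>u = - 2 * \<kappa> * \<Phi>\<^sub>x / \<Phi>\<close> for the heat extension \<open>\<Phi>\<close> of \<open>v\<close>, written with moments; the common
  factor of numerator and denominator has been cancelled. The recursions for the derivatives of the
  moments make each derivative of \<open>u\<close> a rational function of the moments, and the equation reduces to
  an identity in the field they generate, using \<open>4 * \<kappa> * \<sigma> t * t = 1\<close>.\<close>

lemma cole_hopf_burgers:
  fixes \<kappa> :: real
  assumes \<kappa>: "\<kappa> > 0" and pos: "\<And>x s. s > 0 \<Longrightarrow> gauss_moment 0 v x s > 0"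
  defines "u \<equiv> \<lambda>x t. gauss_moment 1 v x (1 / (4 * \<kappa> * t)) / (t * gauss_moment 0 v x (1 / (4 * \<kappa> * t)))"
  shows "\<exists>ut ux uxx.
        continuous_on (UNIV \<times> {0<..}) (\<lambda>(x, t). ut x t) \<and>
        continuous_on (UNIV \<times> {0<..}) (\<lambda>(x, t). ux x t) \<and>
        continuous_on (UNIV \<times> {0<..}) (\<lambda>(x, t). uxx x t) \<and>
        (\<forall>x t. t > 0 \<longrightarrow>
           ((\<lambda>s. u x s) has_real_derivative ut x t) (at t) \<and>
           ((\<lambda>y. u y t) has_real_derivative ux x t) (at x) \<and>
           ((\<lambda>y. ux y t) has_real_derivative uxx x t) (at x) \<and>
           ut x t + u x t * ux x t = \<kappa> * uxx x t)"
proof -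
  define \<sigma> where "\<sigma> = (\<lambda>t. 1 / (4 * \<kappa> * t))"
  define J where "J = (\<lambda>k x t. gauss_moment k v x (\<sigma> t))"
  have \<sigma>pos: "\<sigma> t > 0" if "t > 0" for t using that \<kappa> by (simp add: \<sigma>_def)
  have J0: "J 0 x t > 0" if "t > 0" for x t using pos[OF \<sigma>pos[OF that]] by (simp add: J_def)
  have u: "u = (\<lambda>x t. J 1 x t / (t * J 0 x t))" by (simp add: u_def J_def \<sigma>_def)
  have Jx: "((\<lambda>z. J k z t) has_real_derivative (real k * J (k - 1) x t - 2 * \<sigma> t * J (Suc k) x t)) (at x)"
    if "t > 0" for k x t
    unfolding J_def by (rule gauss_moment_deriv_x[OF \<sigma>pos[OF that]])
  have \<sigma>t: "(\<sigma> has_real_derivative - \<sigma> t / t) (at t)" if "t > 0" for t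
    unfolding \<sigma>_def using that \<kappa> by (auto intro!: derivative_eq_intros simp: field_simps power2_eq_square)
  have Jt: "((\<lambda>t. J k x t) has_real_derivative (\<sigma> t / t * J (k + 2) x t)) (at t)" if "t > 0" for k x t
    using DERIV_chain2[OF gauss_moment_deriv_s[OF \<sigma>pos[OF that]] \<sigma>t[OF that], of k x] unfolding J_def by (simp add: mult_ac)
  have Jc: "continuous_on (UNIV \<times> {0<..}) (\<lambda>z. J k (fst z) (snd z))" for k
    using gauss_moment_continuous'[OF \<kappa>] by (simp add: J_def \<sigma>_def)
  have \<sigma>c: "continuous_on (UNIV \<times> {0<..}) (\<lambda>z::real\<times>real. \<sigma> (snd z))"
    unfolding \<sigma>_def using \<kappa> by (auto intro!: continuous_intros)
  define ut where "ut = (\<lambda>x t. - J 1 x t / (t\<^sup>2 * J 0 x t)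
     + \<sigma> t / t\<^sup>2 * (J 3 x t / J 0 x t - J 1 x t * J 2 x t / (J 0 x t)\<^sup>2))"
  define ux where "ux = (\<lambda>x t. (1 - 2 * \<sigma> t * J 2 x t / J 0 x t + 2 * \<sigma> t * (J 1 x t)\<^sup>2 / (J 0 x t)\<^sup>2) / t)"
  define uxx where "uxx = (\<lambda>x t. (- 2 * \<sigma> t * ((2 * J 1 x t - 2 * \<sigma> t * J 3 x t) / J 0 x t + 2 * \<sigma> t * J 1 x t * J 2 x t / (J 0 x t)\<^sup>2)
     + 2 * \<sigma> t * (2 * J 1 x t * (J 0 x t - 2 * \<sigma> t * J 2 x t) / (J 0 x t)\<^sup>2 + 4 * \<sigma> t * (J 1 x t) ^ 3 / (J 0 x t) ^ 3)) / t)"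
  have nz: "J 0 x t \<noteq> 0" if "t > 0" for x t
    using that J0[of t x] by auto
  show ?thesis
  proof (rule exI[of _ ut], rule exI[of _ ux], rule exI[of _ uxx], intro conjI allI impI)
    show "continuous_on (UNIV \<times> {0<..}) (\<lambda>(x, t). ut x t)"
      unfolding ut_def case_prod_beta by (intro continuous_intros Jc \<sigma>c) (auto simp: nz)
    show "continuous_on (UNIV \<times> {0<..}) (\<lambda>(x, t). ux x t)"
      unfolding ux_def case_prod_beta by (intro continuous_intros Jc \<sigma>c) (auto simp: nz)
    show "continuous_on (UNIV \<times> {0<..}) (\<lambda>(x, t). uxx x t)"
      unfolding uxx_def case_prod_beta by (intro continuous_intros Jc \<sigma>c) (auto simp: nz)
  next
    fix x t :: real assume t: "t > 0"
    have n: "J 0 x t \<noteq> 0" using J0[OF t, of x] by auto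
    note Jx0 = Jx[OF t, of 0 x, simplified] and Jx1 = Jx[OF t, of 1 x, simplified]
      and Jx2 = Jx[OF t, of 2 x, simplified]
    note Jt0 = Jt[OF t, of 0 x, simplified] and Jt1 = Jt[OF t, of 1 x, simplified]
    have num: "Suc (Suc 0) = 2" "Suc 2 = 3" by simp_all
    show "((\<lambda>s. u x s) has_real_derivative ut x t) (at t)"
      unfolding u using n t
      by (auto intro!: derivative_eq_intros Jt0 Jt1 simp: ut_def num field_simps power2_eq_square)
    show "((\<lambda>y. u y t) has_real_derivative ux x t) (at x)"
      unfolding u using n t
      by (auto intro!: derivative_eq_intros Jx0 Jx1 simp: ux_def num field_simps power2_eq_square)
    show "((\<lambda>y. ux y t) has_real_derivative uxx x t) (at x)"
      unfolding ux_def using n t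
      by (auto intro!: derivative_eq_intros Jx0 Jx1 Jx2 simp: uxx_def num field_simps power2_eq_square power3_eq_cube)
    have k: "\<kappa> = 1 / (4 * \<sigma> t * t)" using t \<kappa> by (simp add: \<sigma>_def)
    show "ut x t + u x t * ux x t = \<kappa> * uxx x t"
      unfolding u ut_def ux_def uxx_def k using n t \<sigma>pos[OF t]
      by (simp add: field_simps power2_eq_square power3_eq_cube)
  qed
qed

end

section \<open>Averages against the heat kernel\<close>

lemma heat_kernel_normal_density:
  assumes "\<kappa> > 0" "t > 0"
  shows "heat_kernel \<kappa> x y t = normal_density x (sqrt (2 * \<kappa> * t)) y"
  using assms by (simp add: heat_kernel_def normal_density_def power2_commute[of x y] mult_ac)

lemma heat_kernel_gauss:
  assumes "\<kappa> > 0" "t > 0"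
  shows "heat_kernel \<kappa> x y t = 1 / sqrt (4 * pi * \<kappa> * t) * exp (- (1 / (4 * \<kappa> * t)) * (x - y)\<^sup>2)"
  by (simp add: heat_kernel_def)

lemma heat_kernel_nonneg: "\<kappa> > 0 \<Longrightarrow> t > 0 \<Longrightarrow> heat_kernel \<kappa> x y t \<ge> 0"
  by (simp add: heat_kernel_def)

lemma heat_kernel_measurable [measurable]: "(\<lambda>y. heat_kernel \<kappa> x y t) \<in> borel_measurable borel"
  unfolding heat_kernel_def by measurable

lemma integrable_heat_kernel: "\<kappa> > 0 \<Longrightarrow> t > 0 \<Longrightarrow> integrable lborel (\<lambda>y. heat_kernel \<kappa> x y t)"
  by (simp add: heat_kernel_normal_density)

lemma integral_heat_kernel: "\<kappa> > 0 \<Longrightarrow> t > 0 \<Longrightarrow> (LINT y|lborel. heat_kernel \<kappa> x y t) = 1"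
  by (simp add: heat_kernel_normal_density)

lemma deriv_heat_kernel:
  assumes "\<kappa> > 0" "t > 0"
  shows "deriv (\<lambda>z. heat_kernel \<kappa> z y t) x = - ((x - y) / (2 * \<kappa> * t)) * heat_kernel \<kappa> x y t"
proof (rule DERIV_imp_deriv)
  define c where "c = 1 / sqrt (4 * pi * \<kappa> * t)"
  show "((\<lambda>z. heat_kernel \<kappa> z y t) has_real_derivative - ((x - y) / (2 * \<kappa> * t)) * heat_kernel \<kappa> x y t) (at x)"
    unfolding heat_kernel_def c_def[symmetric]
    using assms by (auto intro!: derivative_eq_intros simp: field_simps)
qed

definition heat_average :: "real \<Rightarrow> (real \<Rightarrow> real) \<Rightarrow> real \<Rightarrow> real \<Rightarrow> real" where
  "heat_average \<kappa> w x t = (LINT y|lborel. heat_kernel \<kappa> x y t * w y)"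

definition heat_average_deriv :: "real \<Rightarrow> (real \<Rightarrow> real) \<Rightarrow> real \<Rightarrow> real \<Rightarrow> real" where
  "heat_average_deriv \<kappa> w x t = (LINT y|lborel. deriv (\<lambda>z. heat_kernel \<kappa> z y t) x * w y)"

text \<open>Moving the dependence on \<open>(x, t)\<close> from the kernel into the argument of \<open>w\<close> lets regularity of \<open>w\<close>
  carry over to the average without any factor that is singular at \<open>t = 0\<close>.\<close>

lemma heat_average_substitution:
  assumes "\<kappa> > 0" "t > 0"
  shows "heat_average \<kappa> w x t = (LINT \<xi>|lborel. std_normal_density \<xi> * w (x + sqrt (2 * \<kappa> * t) * \<xi>))"
proof -
  define c where "c = sqrt (2 * \<kappa> * t)"
  have c: "c > 0" "c\<^sup>2 = 2 * \<kappa> * t" using assms by (auto simp: c_def)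
  have "heat_average \<kappa> w x t = (LINT \<xi>|lborel. c * (normal_density x c (x + c * \<xi>) * w (x + c * \<xi>)))"
    unfolding heat_average_def heat_kernel_normal_density[OF assms] c_def[symmetric]
    by (subst lborel_integral_real_affine[where c = c and t = x]) (use c in auto)
  also have "(\<lambda>\<xi>. c * (normal_density x c (x + c * \<xi>) * w (x + c * \<xi>))) = (\<lambda>\<xi>. std_normal_density \<xi> * w (x + c * \<xi>))"
    using c(1) by (auto simp: normal_density_def fun_eq_iff real_sqrt_mult power_mult_distrib)
  finally show ?thesis by (simp add: c_def)
qed

context bounded_data
begin

lemma integrable_heat: 
  assumes "\<kappa> > 0" "t > 0" shows "integrable lborel (\<lambda>y. heat_kernel \<kappa> x y t * v y)"
proof (rule Bochner_Integration.integrable_bound[OF integrable_mult_left[OF integrable_heat_kernel[OF assms, of x], of B]])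
  show "AE y in lborel. norm (heat_kernel \<kappa> x y t * v y) \<le> norm (heat_kernel \<kappa> x y t * B)"
    using bounded by (auto intro!: AE_I2 mult_left_mono simp: abs_mult intro: order_trans[OF _ abs_ge_self])
qed auto

lemma integrable_std_normal: "integrable lborel (\<lambda>\<xi>. std_normal_density \<xi> * v (x + c * \<xi>))"
proof (rule Bochner_Integration.integrable_bound[OF integrable_mult_left[OF integrable_normal_density[of 1 0], of B]])
  show "AE y in lborel. norm (std_normal_density y * v (x + c * y)) \<le> norm (std_normal_density y * B)"
    using bounded by (auto intro!: AE_I2 mult_left_mono simp: abs_mult intro: order_trans[OF _ abs_ge_self])
qed auto

lemma heat_average_gauss_moment:
  assumes "\<kappa> > 0" "t > 0"
  shows "heat_average \<kappa> v x t = 1 / sqrt (4 * pi * \<kappa> * t) * gauss_moment 0 v x (1 / (4 * \<kappa> * t))"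
  unfolding heat_average_def gauss_moment_def heat_kernel_gauss[OF assms]
  by (simp only: integral_mult_right_zero[symmetric]) (simp add: mult_ac)

lemma heat_average_deriv_gauss_moment:
  assumes "\<kappa> > 0" "t > 0"
  shows "heat_average_deriv \<kappa> v x t =
    - 1 / (2 * \<kappa> * t * sqrt (4 * pi * \<kappa> * t)) * gauss_moment 1 v x (1 / (4 * \<kappa> * t))"
  unfolding heat_average_deriv_def gauss_moment_def deriv_heat_kernel[OF assms] 
  unfolding heat_kernel_gauss[OF assms]
  by (simp only: integral_mult_right_zero[symmetric]) (simp add: mult_ac)

lemma integrable_heat_deriv: 
  assumes "\<kappa> > 0" "t > 0" shows "integrable lborel (\<lambda>y. deriv (\<lambda>z. heat_kernel \<kappa> z y t) x * v y)"
proof -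
  have "integrable lborel (\<lambda>y. - 1 / (2 * \<kappa> * t * sqrt (4 * pi * \<kappa> * t)) * ((x - y) ^ 1 * exp (- (1 / (4 * \<kappa> * t)) * (x - y)\<^sup>2) * v y))"
    using assms by (intro integrable_mult_right integrable_gauss_moment) auto
  then show ?thesis
    unfolding deriv_heat_kernel[OF assms] 
    unfolding heat_kernel_gauss[OF assms] by (simp add: mult_ac)
qed

lemma heat_average_has_derivative:
  assumes "\<kappa> > 0" "t > 0"
  shows "((\<lambda>x. heat_average \<kappa> v x t) has_real_derivative heat_average_deriv \<kappa> v x t) (at x)"
proof -
  have s: "1 / (4 * \<kappa> * t) > 0" using assms by simp
  show ?thesis
    unfolding heat_average_gauss_moment[OF assms] heat_average_deriv_gauss_moment[OF assms]
    by (rule DERIV_cong[OF DERIV_cmult[OF gauss_moment_deriv_x[OF s]]]) (use assms in \<open>simp add: field_simps\<close>)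
qed

lemma heat_average_upper:
  assumes "\<kappa> > 0" "t > 0" shows "\<bar>heat_average \<kappa> v x t\<bar> \<le> B"
proof -
  have "\<bar>heat_average \<kappa> v x t\<bar> \<le> (LINT y|lborel. heat_kernel \<kappa> x y t * B)"
    unfolding heat_average_def
    using Bochner_Integration.integral_norm_bound_integral[OF integrable_heat[OF assms], of "\<lambda>y. heat_kernel \<kappa> x y t * B" x]
      bounded heat_kernel_nonneg[OF assms] integrable_heat_kernel[OF assms]
    by (auto intro!: mult_left_mono simp: abs_mult)
  then show ?thesis by (simp add: integral_heat_kernel[OF assms])
qed

lemma heat_average_lower:
  assumes "\<kappa> > 0" "t > 0" and c: "\<And>y. c \<le> v y" shows "c \<le> heat_average \<kappa> v x t"
proof -
  have "(LINT y|lborel. heat_kernel \<kappa> x y t * c) \<le> heat_average \<kappa> v x t"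
    unfolding heat_average_def
    using c heat_kernel_nonneg[OF assms(1,2)] integrable_heat_kernel[OF assms(1,2)]
    by (intro integral_mono integrable_heat assms) (auto intro!: mult_left_mono)
  then show ?thesis by (simp add: integral_heat_kernel[OF assms(1,2)])
qed

text \<open>Averaging does not increase the Lipschitz constant, so the derivative of the average is
  at most \<open>L\<close>, uniformly in \<open>t\<close>, although the differentiated kernel itself has an \<open>L\<^sup>1\<close> norm that blows
  up as \<open>t\<close> tends to 0.\<close>

lemma heat_average_deriv_lipschitz:
  assumes k: "\<kappa> > 0" "t > 0" and L: "\<And>a b. \<bar>v a - v b\<bar> \<le> L * \<bar>a - b\<bar>"
  shows "\<bar>heat_average_deriv \<kappa> v x t\<bar> \<le> L"
proof -
  have lip: "\<bar>heat_average \<kappa> v z t - heat_average \<kappa> v x t\<bar> \<le> L * \<bar>z - x\<bar>" for z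
  proof -
    define c where "c = sqrt (2 * \<kappa> * t)"
    have "heat_average \<kappa> v z t - heat_average \<kappa> v x t =
       (LINT \<xi>|lborel. std_normal_density \<xi> * (v (z + c * \<xi>) - v (x + c * \<xi>)))"
      unfolding heat_average_substitution[OF k] c_def[symmetric] right_diff_distrib
      by (simp add: integrable_std_normal)
    also have "\<bar>\<dots>\<bar> \<le> (LINT \<xi>|lborel. std_normal_density \<xi> * (L * \<bar>z - x\<bar>))"
    proof -
      have "integrable lborel (\<lambda>\<xi>. std_normal_density \<xi> * (v (z + c * \<xi>) - v (x + c * \<xi>)))"
        unfolding right_diff_distrib by (intro Bochner_Integration.integrable_diff integrable_std_normal)
      moreover have "\<bar>std_normal_density \<xi> * (v (z + c * \<xi>) - v (x + c * \<xi>))\<bar> \<le> std_normal_density \<xi> * (L * \<bar>z - x\<bar>)" for \<xi>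
        using L[of "z + c * \<xi>" "x + c * \<xi>"] by (auto intro!: mult_left_mono simp: abs_mult)
      ultimately show ?thesis
        unfolding real_norm_def[symmetric] by (intro Bochner_Integration.integral_norm_bound_integral) auto
    qed
    finally show ?thesis by simp
  qed
  have "((\<lambda>z. \<bar>(heat_average \<kappa> v z t - heat_average \<kappa> v x t) / (z - x)\<bar>) \<longlongrightarrow> \<bar>heat_average_deriv \<kappa> v x t\<bar>) (at x)"
    using heat_average_has_derivative[OF k] by (intro tendsto_rabs) (simp add: has_field_derivative_iff)
  then show ?thesis
  proof (rule tendsto_upperbound)
    have "\<forall>\<^sub>F z in at x. z \<noteq> x" by (simp add: eventually_at_filter)
    then show "\<forall>\<^sub>F z in at x. \<bar>(heat_average \<kappa> v z t - heat_average \<kappa> v x t) / (z - x)\<bar> \<le> L"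
      by eventually_elim (use lip in \<open>simp add: abs_divide divide_le_eq\<close>)
  qed simp
qed

text \<open>Integration by parts without boundary terms: the average is differentiated once under the kernel
  and once after the substitution, and derivatives are unique.\<close>

lemma heat_average_deriv_by_parts:
  assumes k: "\<kappa> > 0" "t > 0" and v': "bounded_data v' L" and der: "\<And>y. (v has_real_derivative v' y) (at y)"
  shows "heat_average_deriv \<kappa> v x t = heat_average \<kappa> v' x t"
proof -
  interpret v': bounded_data v' L by fact
  define c where "c = sqrt (2 * \<kappa> * t)"
  have "((\<lambda>z. LINT \<xi>|lborel. std_normal_density \<xi> * v (z + c * \<xi>)) has_real_derivative
      (LINT \<xi>|lborel. std_normal_density \<xi> * v' (x + c * \<xi>))) (at x)"
  proof (rule has_real_derivative_integral[where r = 1 and f' = "\<lambda>z \<xi>. std_normal_density \<xi> * v' (z + c * \<xi>)" and g = "\<lambda>\<xi>. std_normal_density \<xi> * L"])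
    show "((\<lambda>z. std_normal_density \<xi> * v (z + c * \<xi>)) has_real_derivative std_normal_density \<xi> * v' (z + c * \<xi>)) (at z)" for z \<xi>
      by (rule DERIV_cong[OF DERIV_cmult[OF DERIV_chain2[OF der]]]) (auto intro!: derivative_eq_intros)
    show "\<bar>std_normal_density \<xi> * v' (z + c * \<xi>)\<bar> \<le> std_normal_density \<xi> * L" for z \<xi>
      using v'.bounded by (auto simp: abs_mult intro!: mult_left_mono)
  qed (auto intro: integrable_std_normal)
  then have "((\<lambda>x. heat_average \<kappa> v x t) has_real_derivative heat_average \<kappa> v' x t) (at x)"
    unfolding heat_average_substitution[OF k] c_def .
  then show ?thesis using heat_average_has_derivative[OF k] DERIV_unique by blast
qed

text \<open>The kernel is an approximate identity, jointly in space and time.\<close>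

lemma heat_average_initial:
  assumes k: "\<kappa> > 0" and cont: "continuous_on UNIV v"
  shows "((\<lambda>z. heat_average \<kappa> v (fst z) (snd z)) \<longlongrightarrow> v x) (at (x, 0) within UNIV \<times> {0<..})"
proof -
  have "((\<lambda>z. LINT \<xi>|lborel. std_normal_density \<xi> * v (fst z + sqrt (2 * \<kappa> * snd z) * \<xi>)) \<longlongrightarrow>
     (LINT \<xi>|lborel. std_normal_density \<xi> * v x)) (at (x, 0) within UNIV \<times> {0<..})"
  proof (rule tendsto_integral_dominated[where g = "\<lambda>\<xi>. std_normal_density \<xi> * B"])
    show "((\<lambda>z. std_normal_density \<xi> * v (fst z + sqrt (2 * \<kappa> * snd z) * \<xi>)) \<longlongrightarrow> std_normal_density \<xi> * v x)
       (at (x, 0) within UNIV \<times> {0<..})" for \<xi>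
    proof (intro tendsto_mult tendsto_const)
      have "isCont v x" using cont by (simp add: continuous_on_eq_continuous_at)
      then show "((\<lambda>z. v (fst z + sqrt (2 * \<kappa> * snd z) * \<xi>)) \<longlongrightarrow> v x) (at (x, 0) within UNIV \<times> {0<..})"
        by (rule isCont_tendsto_compose) (auto intro!: tendsto_eq_intros)
    qed
    show "\<forall>\<^sub>F z in at (x, 0) within UNIV \<times> {0<..}. \<forall>\<xi>\<in>space lborel.
       \<bar>std_normal_density \<xi> * v (fst z + sqrt (2 * \<kappa> * snd z) * \<xi>)\<bar> \<le> std_normal_density \<xi> * B"
      using bounded by (auto simp: abs_mult intro!: mult_left_mono always_eventually)
  qed auto
  moreover have "\<forall>\<^sub>F z in at (x, 0::real) within UNIV \<times> {0<..}.
     (LINT \<xi>|lborel. std_normal_density \<xi> * v (fst z + sqrt (2 * \<kappa> * snd z) * \<xi>)) = heat_average \<kappa> v (fst z) (snd z)"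
    using k by (auto simp: eventually_at heat_average_substitution intro!: exI[of _ 1])
  ultimately show ?thesis using tendsto_cong by (fastforce simp: integral_normal_density)
qed

end

section \<open>Periodic meshes and piecewise linear functions\<close>

lemma periodic_int:
  fixes w :: "real \<Rightarrow> 'a"
  assumes "\<And>y. w (y + 2 * pi) = w y"
  shows "w (y + 2 * pi * of_int k) = w y"
proof (induction k rule: int_induct[where k = 0])
  case (step1 i)
  then show ?case using assms[of "y + 2 * pi * of_int i"] by (simp add: algebra_simps)
next
  case (step2 i)
  then show ?case using assms[of "y + 2 * pi * of_int (i - 1)"] by (simp add: algebra_simps)
qed simp

locale mesh =
  fixes m :: nat and x :: "nat \<Rightarrow> real" and h :: real
  assumes is_mesh: "is_mesh m x h"
begin

abbreviation e :: "int \<Rightarrow> real" where "e \<equiv> ext_mesh m x"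

lemma m_pos: "m \<ge> 1" and x_first: "x 0 = - pi" and x_last: "x m = pi"
  and x_less: "j \<in> {1..m} \<Longrightarrow> x (j - 1) < x j" and x_step: "j \<in> {1..m} \<Longrightarrow> x j - x (j - 1) \<le> h"
  using is_mesh unfolding is_mesh_def by blast+

text \<open>With the wrap-around hidden in \<open>x m = x 0 + 2 * pi\<close>, every extended cell is a translate of a cell
  of the mesh.\<close>

lemma ext_mesh_Suc: "e (i + 1) = x (Suc (nat (i mod int m))) + 2 * pi * of_int (i div int m)"
proof (cases "i mod int m = int m - 1")
  case True
  have "(i + 1) mod int m = (i mod int m + 1) mod int m" by (simp add: mod_add_left_eq)
  then have 1: "(i + 1) mod int m = 0" using True by simp
  have "i + 1 = int m * (i div int m) + (i mod int m + 1)" by simp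
  then have "i + 1 = int m * (i div int m + 1)" unfolding True by (simp add: algebra_simps)
  then have 2: "(i + 1) div int m = i div int m + 1" using m_pos by simp
  have "Suc (nat (i mod int m)) = m" using True m_pos by simp
  then show ?thesis using 1 2 x_first x_last by (simp add: ext_mesh_def algebra_simps)
next
  case False
  have "i mod int m < int m" "i mod int m \<ge> 0" using m_pos by auto
  then have "i mod int m + 1 < int m" "0 \<le> i mod int m" using False by auto
  moreover have "i + 1 = (i mod int m + 1) + int m * (i div int m)" by simp
  ultimately have "(i + 1) mod int m = i mod int m + 1" "(i + 1) div int m = i div int m"
    using m_pos by (metis add_nonneg_nonneg mod_mult_self2 mod_pos_pos_trivial zero_le_one,
      metis add_nonneg_nonneg add.commute add_0 div_mult_self2 div_pos_pos_trivial of_nat_0_eq_iff not_one_le_zero zero_le_one)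
  then show ?thesis using \<open>0 \<le> i mod int m\<close> by (simp add: ext_mesh_def nat_add_distrib)
qed

lemma mod_index: "Suc (nat (i mod int m)) \<in> {1..m}"
  using m_pos pos_mod_bound[of "int m" i] pos_mod_sign[of "int m" i] by (simp add: nat_less_iff Suc_le_eq)

lemma e_less_Suc: "e i < e (i + 1)"
  using x_less[OF mod_index[of i]] by (simp add: ext_mesh_Suc) (simp add: ext_mesh_def)

lemma e_step: "e (i + 1) - e i \<le> h"
  using x_step[OF mod_index[of i]] by (simp add: ext_mesh_Suc) (simp add: ext_mesh_def)

lemma e_mono: "i \<le> j \<Longrightarrow> e i \<le> e j"
proof (induction j rule: int_ge_induct)
  case (step j)
  then show ?case using e_less_Suc[of j] by simp
qed simp

lemma e_period: "e (i + int m * k) = e i + 2 * pi * of_int k"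
  using m_pos by (simp add: ext_mesh_def algebra_simps)

lemma e_nat: "j < m \<Longrightarrow> e (int j) = x j"
  by (simp add: ext_mesh_def nat_mod_as_int)

text \<open>The node that opens the period containing \<open>y\<close> lies to the left of \<open>y\<close>, and \<open>m\<close> steps lead past \<open>y\<close>.\<close>

lemma cell_ex: "\<exists>i. e i \<le> y \<and> y < e (i + 1)"
proof -
  have find: "e a \<le> y \<Longrightarrow> y < e (a + int n) \<Longrightarrow> \<exists>i. e i \<le> y \<and> y < e (i + 1)" for a n
  proof (induction n)
    case (Suc n)
    show ?case
    proof (cases "y < e (a + int n)")
      case False
      then show ?thesis using Suc.prems by (intro exI[of _ "a + int n"]) (auto simp: algebra_simps)
    qed (use Suc in auto)
  qed simp
  define k where "k = \<lfloor>(y + pi) / (2 * pi)\<rfloor>"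
  have "of_int k \<le> (y + pi) / (2 * pi)" "(y + pi) / (2 * pi) < of_int k + 1"
    unfolding k_def by linarith+
  then have "2 * pi * of_int k \<le> y + pi" "y + pi < 2 * pi * (of_int k + 1)"
    by (auto simp: field_simps)
  moreover have "e (int m * k) = - pi + 2 * pi * of_int k" "e (int m * k + int m) = - pi + 2 * pi * (of_int k + 1)"
    using e_period[of 0 k] e_period[of 0 "k + 1"] m_pos e_nat[of 0] x_first by (auto simp: algebra_simps)
  ultimately show ?thesis by (intro find[of "int m * k" m]) auto
qed

lemma cell_unique: "e i \<le> y \<Longrightarrow> y < e (i + 1) \<Longrightarrow> e j \<le> y \<Longrightarrow> y < e (j + 1) \<Longrightarrow> i = j"
  using e_mono[of "i + 1" j] e_mono[of "j + 1" i] by force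

lemma cell_eqI: "e i \<le> y \<Longrightarrow> y < e (i + 1) \<Longrightarrow> cell m x y = i"
  unfolding cell_def by (intro the_equality) (auto intro: cell_unique)

lemma cell_bounds: "e (cell m x y) \<le> y" "y < e (cell m x y + 1)"
  using cell_ex[of y] cell_eqI by auto

lemma cell_measurable [measurable]: "cell m x \<in> borel \<rightarrow>\<^sub>M count_space UNIV"
proof (subst measurable_count_space_eq2_countable, safe)
  fix i
  have "cell m x -` {i} = {e i..<e (i + 1)}" using cell_bounds by (auto intro: cell_eqI)
  then show "cell m x -` {i} \<inter> space borel \<in> sets borel" by simp
qed auto

text \<open>The formula extends to the right endpoint, where \<open>cell\<close> has already jumped to the next index; this is
  the continuity of piecewise linear functions.\<close>

lemma pl_function_closed_cell:
  assumes "e i \<le> y" "y \<le> e (i + 1)"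
  shows "pl_function m x c y = c i + (c (i + 1) - c i) * (y - e i) / (e (i + 1) - e i)"
proof (cases "y = e (i + 1)")
  case True
  then have "cell m x y = i + 1" using e_less_Suc[of "i + 1"] by (intro cell_eqI) auto
  then show ?thesis using True e_less_Suc[of i] by (simp add: pl_function_def Let_def)
next
  case False
  then have "cell m x y = i" using assms by (intro cell_eqI) auto
  then show ?thesis by (simp add: pl_function_def Let_def)
qed

text \<open>The bounds on the cells between two points add up by the triangle inequality.\<close>

lemma lipschitz_of_cells:
  fixes f :: "real \<Rightarrow> real"
  assumes loc: "\<And>i a b. \<lbrakk>e i \<le> a; a \<le> b; b \<le> e (i + 1)\<rbrakk> \<Longrightarrow> \<bar>f a - f b\<bar> \<le> L * (b - a)"
  shows "\<bar>f a - f b\<bar> \<le> L * \<bar>a - b\<bar>"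
proof -
  have chain: "\<bar>f a - f b\<bar> \<le> L * (b - a)" if "i \<le> j" "e i \<le> a" "a \<le> e (i + 1)" "a \<le> b" "e j \<le> b" "b \<le> e (j + 1)" for i j a b
    using that(1,4-)
  proof (induction j arbitrary: b rule: int_ge_induct)
    case base
    then show ?case using that by (intro loc[of i]) auto
  next
    case (step j)
    have ij: "e (i + 1) \<le> e (j + 1)" using step.hyps by (intro e_mono) simp
    have "\<bar>f a - f (e (j + 1))\<bar> \<le> L * (e (j + 1) - a)"
      using e_less_Suc[of j] that ij by (intro step.IH) auto
    moreover have "\<bar>f (e (j + 1)) - f b\<bar> \<le> L * (b - e (j + 1))"
      using step.prems by (intro loc[of "j + 1"]) auto
    ultimately show ?case by (simp add: algebra_simps abs_if split: if_splits)
  qed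
  have le: "\<bar>f a - f b\<bar> \<le> L * (b - a)" if "a \<le> b" for a b
  proof (rule chain)
    show "cell m x a \<le> cell m x b"
      using cell_bounds[of a] cell_bounds[of b] that e_mono[of "cell m x b + 1" "cell m x a"] by force
  qed (use that cell_bounds[of a] cell_bounds[of b] in auto)
  show ?thesis
    using le[of a b] le[of b a] by (cases "a \<le> b") (auto simp: abs_minus_commute)
qed

lemma h_pos: "h > 0" using x_less[of 1] x_step[of 1] m_pos by auto

text \<open>The link between mesh width and number of cells: \<open>m\<close> steps of length at most \<open>h\<close> cover \<open>2 * pi\<close>.\<close>

lemma inverse_m_le: "1 / real m \<le> h / (2 * pi)"
proof -
  have "j \<le> m \<Longrightarrow> x j \<le> - pi + real j * h" for j
  proof (induction j)
    case (Suc j)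
    then show ?case using x_step[of "Suc j"] by (simp add: algebra_simps)
  qed (simp add: x_first)
  from this[of m] have "2 * pi \<le> real m * h" by (simp add: x_last)
  then show ?thesis using m_pos by (simp add: field_simps)
qed

lemma periodic_at_node:
  assumes "\<And>y. w (y + 2 * pi) = w y"
  shows "w (e i) = w (x (nat (i mod int m)))"
  unfolding ext_mesh_def by (rule periodic_int[where w = w, OF assms])

lemma interp0_measurable [measurable]: "interp0 m x f \<in> borel_measurable borel"
  unfolding interp0_def by measurable

lemma pl_function_measurable [measurable]: "pl_function m x c \<in> borel_measurable borel"
  unfolding pl_function_def Let_def by measurable

text \<open>The mass that the heat kernel centred at \<open>y\<close> gives to the union of the periodic copies of the
  cell with left endpoint \<open>x j\<close>.\<close>

definition cell_weight :: "real \<Rightarrow> real \<Rightarrow> real \<Rightarrow> nat \<Rightarrow> real" where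
  "cell_weight \<kappa> y t j = heat_average \<kappa> (\<lambda>z. if cell m x z mod int m = int j then 1 else 0) y t"

lemma heat_average_interp0:
  assumes k: "\<kappa> > 0" "t > 0" and per: "\<And>y. w (y + 2 * pi) = w y"
  shows "heat_average \<kappa> (interp0 m x w) y t = (\<Sum>j<m. cell_weight \<kappa> y t j * w (x j))"
proof -
  have bd: "bounded_data (\<lambda>z. if cell m x z mod int m = int j then 1 else 0) 1" for j
    by unfold_locales auto
  have "interp0 m x w z = (\<Sum>j<m. (if cell m x z mod int m = int j then 1 else 0) * w (x j))" for z
  proof -
    define r where "r = nat (cell m x z mod int m)"
    have r: "r < m" "cell m x z mod int m = int r" using mod_index[of "cell m x z"] m_pos by (auto simp: r_def)
    have "(\<Sum>j<m. (if cell m x z mod int m = int j then 1 else 0) * w (x j)) = (\<Sum>j<m. if r = j then w (x j) else 0)"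
      by (intro sum.cong) (auto simp: r)
    also have "\<dots> = w (x r)" using r by simp
    finally show ?thesis unfolding interp0_def periodic_at_node[of w, OF per] r_def by simp
  qed
  then have "heat_average \<kappa> (interp0 m x w) y t = 
     (LINT z|lborel. (\<Sum>j<m. heat_kernel \<kappa> y z t * (if cell m x z mod int m = int j then 1 else 0) * w (x j)))"
    unfolding heat_average_def by (simp add: sum_distrib_left mult_ac)
  also have "\<dots> = (\<Sum>j<m. LINT z|lborel. heat_kernel \<kappa> y z t * (if cell m x z mod int m = int j then 1 else 0) * w (x j))"
    by (rule Bochner_Integration.integral_sum) (intro integrable_mult_left bounded_data.integrable_heat[OF bd k])
  finally show ?thesis by (simp add: cell_weight_def heat_average_def)
qed

lemma cell_weight_nonneg: "\<kappa> > 0 \<Longrightarrow> t > 0 \<Longrightarrow> cell_weight \<kappa> y t j \<ge> 0"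
  unfolding cell_weight_def heat_average_def by (intro integral_nonneg_AE) (auto simp: heat_kernel_nonneg)

lemma sum_cell_weight: "\<kappa> > 0 \<Longrightarrow> t > 0 \<Longrightarrow> (\<Sum>j<m. cell_weight \<kappa> y t j) = 1"
  using heat_average_interp0[of \<kappa> t "\<lambda>_. 1" y]
  by (simp add: interp0_def heat_average_def integral_heat_kernel)

end

section \<open>Pointwise bounds from Sobolev bounds\<close>

text \<open>Squaring smooths the kink of the positive part; this yields continuously differentiable bumps.\<close>

lemma has_real_derivative_max_square:
  "((\<lambda>z::real. (max 0 z)\<^sup>2) has_real_derivative 2 * max 0 z) (at z)"
proof -
  consider "z > 0" | "z < 0" | "z = 0" by linarith
  then show ?thesis
  proof cases
    case 1
    have "((\<lambda>z::real. z\<^sup>2) has_real_derivative 2 * max 0 z) (at z)"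
      using 1 by (auto intro!: derivative_eq_intros)
    then show ?thesis
      by (rule has_field_derivative_transform_within_open[where S = "{0<..}"]) (use 1 in auto)
  next
    case 2
    have "((\<lambda>z::real. 0) has_real_derivative 2 * max 0 z) (at z)"
      using 2 by (auto intro!: derivative_eq_intros)
    then show ?thesis
      by (rule has_field_derivative_transform_within_open[where S = "{..<0}"]) (use 2 in auto)
  next
    case 3
    have "((\<lambda>y::real. max 0 y) \<longlongrightarrow> 0) (at 0)"
      by (rule tendsto_eq_intros refl)+ simp
    moreover have "\<forall>\<^sub>F y::real in at 0. max 0 y = (max 0 y)\<^sup>2 / y"
      by (auto simp: eventually_at_filter max_def power2_eq_square)
    ultimately have "((\<lambda>y::real. (max 0 y)\<^sup>2 / y) \<longlongrightarrow> 0) (at 0)"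
      using tendsto_cong by fast
    then show ?thesis using 3 by (simp add: has_field_derivative_iff)
  qed
qed

lemma period_measure_integral:
  fixes f :: "real \<Rightarrow> real"
  assumes [measurable]: "f \<in> borel_measurable borel"
  shows "(LINT y|period_measure. f y) = (LINT y|lborel. f y * indicator {-pi..pi} y)"
proof -
  have "(LINT y|period_measure. f y) = (LINT y|lebesgue. f y * indicator {-pi<..<pi} y)"
    by (subst integral_restrict_space) (auto simp: mult.commute)
  also have "\<dots> = (LINT y|lborel. f y * indicator {-pi<..<pi} y)"
    by (intro integral_completion) measurable
  also have "\<dots> = (LINT y|lborel. f y * indicator {-pi..pi} y)"
  proof (rule integral_cong_AE)
    have "AE y in lborel. y \<noteq> pi \<and> y \<noteq> - pi" using AE_lborel_singleton[of pi] AE_lborel_singleton[of "- pi"] by eventually_elim auto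
    then show "AE y in lborel. f y * indicator {-pi<..<pi} y = f y * indicator {-pi..pi} y"
      by eventually_elim (auto simp: indicator_def)
  qed auto
  finally show ?thesis .
qed

lemma integrable_period_measure:
  fixes f :: "real \<Rightarrow> real"
  assumes "f \<in> borel_measurable period_measure" "AE y in period_measure. \<bar>f y\<bar> \<le> B"
  shows "integrable period_measure f"
proof -
  have "emeasure period_measure (space period_measure) < \<infinity>"
    by (simp add: emeasure_restrict_space space_restrict_space)
  then have "finite_measure period_measure" by (intro finite_measureI) auto
  then show ?thesis using assms by (intro finite_measure.integrable_const_bound[where B = B]) auto
qed

lemma continuous_measurable_period: 
  fixes f :: "real \<Rightarrow> real"
  assumes "continuous_on UNIV f" shows "f \<in> borel_measurable period_measure"
  using borel_measurable_continuous_onI[OF assms] 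
  by (intro measurable_restrict_space1 measurable_completion) simp

lemma Linf_AE:
  assumes "f \<in> Linf" "Linf_norm f \<le> ereal M"
  shows "AE y in period_measure. \<bar>f y\<bar> \<le> M"
proof -
  have "AE y in period_measure. ereal \<bar>f y\<bar> \<le> Linf_norm f"
    using assms(1) unfolding Linf_norm_def Linf_def by (intro esssup_AE)
  then show ?thesis
    by eventually_elim (use assms(2) in \<open>auto simp flip: ereal_less_eq(3) elim: order_trans\<close>)
qed

text \<open>Tested against a nonnegative bump \<open>\<phi>\<close> supported where \<open>u\<close> is affine, the weak derivative acts as the
  slope: \<open>s * \<integral>\<phi> = \<integral>g \<phi>\<close>. The right side is at most \<open>M * \<integral>\<phi>\<close> in absolute value.\<close>

lemma weak_derivative_bound_slope:
  assumes weak: "weak_derivative u g" and g: "g \<in> Linf" "Linf_norm g \<le> ereal M"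
    and ab: "- pi < a" "a < b" "b < pi"
    and affine: "\<And>y. a \<le> y \<Longrightarrow> y \<le> b \<Longrightarrow> u y = \<alpha> + s * y"
  shows "\<bar>s\<bar> \<le> M"
proof -
  define c r where "c = (a + b) / 2" and "r = (b - a) / 2"
  have cr: "a = c - r" "b = c + r" "r > 0" using ab by (auto simp: c_def r_def field_simps)
  define p where "p = (\<lambda>y. r\<^sup>2 - (y - c)\<^sup>2)"
  define \<phi> where "\<phi> = (\<lambda>y. (max 0 (p y))\<^sup>2)"
  define \<phi>' where "\<phi>' = (\<lambda>y. 2 * max 0 (p y) * (- 2 * (y - c)))"
  have der: "(\<phi> has_real_derivative \<phi>' y) (at y)" for y
    unfolding \<phi>_def \<phi>'_def p_def
    by (rule DERIV_chain2[OF has_real_derivative_max_square]) (auto intro!: derivative_eq_intros)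
  have deriv: "deriv \<phi> = \<phi>'" using der DERIV_imp_deriv by blast
  have cont: "continuous_on UNIV \<phi>" "continuous_on UNIV \<phi>'"
    unfolding \<phi>_def \<phi>'_def p_def by (intro continuous_intros)+
  have out: "max 0 (p y) = 0" if "y \<notin> {a..b}" for y
  proof -
    have "r \<le> \<bar>y - c\<bar>" using that cr by auto
    then have "r\<^sup>2 \<le> (y - c)\<^sup>2" using cr by (metis abs_of_pos abs_le_square_iff)
    then show ?thesis by (simp add: p_def)
  qed
  have test: "test_function \<phi>"
    unfolding test_function_def deriv
    using der cont ab out by (auto simp: field_differentiable_def \<phi>_def intro!: exI[of _ "{a..b}"])
  have out': "\<phi> y = 0" "\<phi>' y = 0" if "y \<notin> {a..b}" for y using out[OF that] by (auto simp: \<phi>_def \<phi>'_def)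
  \<comment> \<open>The derivative of \<open>F\<close> integrates to 0, as \<open>F\<close> vanishes at both endpoints.\<close>
  define F where "F = (\<lambda>y. (\<alpha> + s * y) * \<phi> y)"
  have derF: "(F has_real_derivative (s * \<phi> y + (\<alpha> + s * y) * \<phi>' y)) (at y)" for y
    unfolding F_def by (rule DERIV_cong[OF DERIV_mult[OF _ der]]) (auto intro!: derivative_eq_intros)
  have i1: "integrable lborel (\<lambda>y. \<phi> y * indicator {-pi..pi} y)"
    using borel_integrable_atLeastAtMost[of "- pi" pi \<phi>] cont by (simp add: continuous_on_eq_continuous_at indicator_def if_distrib cong: if_cong)
  have i2: "integrable lborel (\<lambda>y. (\<alpha> + s * y) * \<phi>' y * indicator {-pi..pi} y)"
    using borel_integrable_atLeastAtMost[of "- pi" pi "\<lambda>y. (\<alpha> + s * y) * \<phi>' y"] cont 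
    by (simp add: continuous_on_eq_continuous_at indicator_def if_distrib cong: if_cong)
  have meas: "\<phi> \<in> borel_measurable borel" "\<phi>' \<in> borel_measurable borel"
    using cont by (auto intro: borel_measurable_continuous_onI)
  have "(LINT y|lborel. (s * \<phi> y + (\<alpha> + s * y) * \<phi>' y) * indicator {-pi..pi} y) = F pi - F (- pi)"
    using derF cont by (intro integral_FTC_Icc_real) (auto simp: continuous_on_eq_continuous_at)
  also have "\<dots> = 0" using out'[of pi] out'[of "- pi"] ab by (simp add: F_def)
  also have "(\<lambda>y. (s * \<phi> y + (\<alpha> + s * y) * \<phi>' y) * indicator {-pi..pi} y) =
     (\<lambda>y. s * (\<phi> y * indicator {-pi..pi} y) + (\<alpha> + s * y) * \<phi>' y * indicator {-pi..pi} y)"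
    by (auto simp: algebra_simps)
  finally have "s * (LINT y|lborel. \<phi> y * indicator {-pi..pi} y) + (LINT y|lborel. (\<alpha> + s * y) * \<phi>' y * indicator {-pi..pi} y) = 0"
    using i1 i2 by simp
  then have parts: "s * (LINT y|period_measure. \<phi> y) + (LINT y|period_measure. (\<alpha> + s * y) * \<phi>' y) = 0"
    using meas by (simp add: period_measure_integral)
  have "(\<lambda>y. u y * deriv \<phi> y) = (\<lambda>y. (\<alpha> + s * y) * \<phi>' y)"
    using affine out'(2) unfolding deriv by fastforce
  then have "(LINT y|period_measure. (\<alpha> + s * y) * \<phi>' y) = - (LINT y|period_measure. g y * \<phi> y)"
    using weak test unfolding weak_derivative_def by metis
  then have eq: "s * (LINT y|period_measure. \<phi> y) = (LINT y|period_measure. g y * \<phi> y)" using parts by simp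
  have nonneg: "\<phi> y \<ge> 0" for y by (simp add: \<phi>_def)
  have le: "\<phi> y \<le> r ^ 4" for y
  proof -
    have "(max 0 (p y))\<^sup>2 \<le> (r\<^sup>2)\<^sup>2" by (intro power_mono) (auto simp: p_def)
    then show ?thesis by (simp add: \<phi>_def flip: power_mult)
  qed
  have int\<phi>: "integrable period_measure \<phi>"
    using le nonneg cont by (intro integrable_period_measure[where B = "r ^ 4"] continuous_measurable_period) auto
  have AE: "AE y in period_measure. \<bar>g y * \<phi> y\<bar> \<le> M * \<phi> y"
    using Linf_AE[OF g] by eventually_elim (use nonneg in \<open>simp add: abs_mult mult_right_mono\<close>)
  have gm: "(\<lambda>y. g y * \<phi> y) \<in> borel_measurable period_measure"
    using g(1) continuous_measurable_period[OF cont(1)] by (auto simp: Linf_def)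
  have intg: "integrable period_measure (\<lambda>y. g y * \<phi> y)"
    by (rule Bochner_Integration.integrable_bound[OF integrable_mult_right[OF int\<phi>, of M] gm])
      (use AE in \<open>eventually_elim, auto\<close>)
  have "\<bar>LINT y|period_measure. g y * \<phi> y\<bar> \<le> (LINT y|period_measure. \<bar>g y * \<phi> y\<bar>)" by simp
  also have "\<dots> \<le> (LINT y|period_measure. M * \<phi> y)"
    using AE intg int\<phi> by (intro integral_mono_AE) auto
  finally have "\<bar>s * (LINT y|period_measure. \<phi> y)\<bar> \<le> M * (LINT y|period_measure. \<phi> y)" using eq by simp
  moreover have "(LINT y|period_measure. \<phi> y) > 0"
  proof -
    \<comment> \<open>On the middle half of its support the bump is at least \<open>(3 / 4 * r\<^sup>2)\<^sup>2\<close>.\<close>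
    have "0 < (9 / 16 * r ^ 4) * r" using cr by simp
    also have "\<dots> = (LINT y|lborel. (9 / 16 * r ^ 4) * indicator {c - r / 2..c + r / 2} y)"
      using cr by simp
    also have "\<dots> \<le> (LINT y|lborel. \<phi> y * indicator {-pi..pi} y)"
    proof (rule integral_mono[OF _ i1])
      show "integrable lborel (\<lambda>y. (9 / 16 * r ^ 4) * indicator {c - r / 2..c + r / 2} y :: real)"
        by (intro integrable_mult_right) (auto simp: emeasure_lborel_Icc_eq)
      fix y
      show "(9 / 16 * r ^ 4) * indicator {c - r / 2..c + r / 2} y \<le> \<phi> y * indicator {-pi..pi} y"
      proof (cases "y \<in> {c - r / 2..c + r / 2}")
        case True
        then have "\<bar>y - c\<bar> \<le> \<bar>r / 2\<bar>" using cr by (auto simp: abs_if)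
        then have "(y - c)\<^sup>2 \<le> (r / 2)\<^sup>2" using abs_le_square_iff by blast
        then have "3 / 4 * r\<^sup>2 \<le> p y" by (simp add: p_def power_divide)
        then have "3 / 4 * r\<^sup>2 \<le> max 0 (p y)" by (rule max.coboundedI2)
        then have "(3 / 4 * r\<^sup>2)\<^sup>2 \<le> \<phi> y" unfolding \<phi>_def by (intro power_mono) auto
        moreover have "y \<in> {-pi..pi}" using True ab cr by auto
        ultimately show ?thesis using True by (simp add: power_mult_distrib power_divide flip: power_mult)
      qed (simp add: nonneg)
    qed
    finally show ?thesis using meas by (simp add: period_measure_integral)
  qed
  ultimately show ?thesis by (simp add: abs_mult)
qed

lemma wrap_bounds: "- pi \<le> wrap y" "wrap y < pi"
proof -
  define k where "k = \<lfloor>(y + pi) / (2 * pi)\<rfloor>"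
  have "of_int k \<le> (y + pi) / (2 * pi)" "(y + pi) / (2 * pi) < of_int k + 1" unfolding k_def by linarith+
  then show "- pi \<le> wrap y" "wrap y < pi" unfolding wrap_def k_def[symmetric] by (auto simp: field_simps)
qed

lemma periodic_wrap:
  fixes w :: "real \<Rightarrow> 'a"
  assumes "\<And>y. w (y + 2 * pi) = w y"
  shows "w (wrap y) = w y"
  using periodic_int[where w = w, OF assms, of y "- \<lfloor>(y + pi) / (2 * pi)\<rfloor>"] by (simp add: wrap_def)

text \<open>For a continuous function the set where the bound fails is open, hence empty or of positive measure.\<close>

lemma continuous_bound_of_AE:
  assumes cont: "continuous_on UNIV u" and per: "\<And>y. u (y + 2 * pi) = u y"
    and AE: "AE y in period_measure. \<bar>u y\<bar> \<le> M"
  shows "\<bar>u y\<bar> \<le> (M::real)"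
proof (rule ccontr)
  assume "\<not> \<bar>u y\<bar> \<le> M"
  define T where "T = {y. M < \<bar>u y\<bar>}"
  define z where "z = wrap y"
  have opn: "open T" unfolding T_def
    by (intro open_Collect_less continuous_intros cont)
  have "z \<in> T" using \<open>\<not> \<bar>u y\<bar> \<le> M\<close> periodic_wrap[where w = u, OF per, of y]
    unfolding z_def T_def by auto
  have z: "- pi \<le> z" "z < pi" unfolding z_def by (rule wrap_bounds)+
  obtain \<epsilon> where \<epsilon>: "\<epsilon> > 0" "ball z \<epsilon> \<subseteq> T" using opn \<open>z \<in> T\<close> open_contains_ball by blast
  define z' where "z' = z + min (\<epsilon> / 2) ((pi - z) / 2)"
  have "z' \<in> T" using \<epsilon> z by (intro subsetD[OF \<epsilon>(2)]) (auto simp: z'_def dist_real_def)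
  moreover have "z' \<in> {-pi<..<pi}" using z \<epsilon>(1) by (auto simp: z'_def min_def field_simps)
  ultimately have ne: "T \<inter> {-pi<..<pi} \<noteq> {}" by auto
  have "AE y in lebesgue. y \<in> {-pi<..<pi} \<longrightarrow> \<bar>u y\<bar> \<le> M"
    using AE by (subst (asm) AE_restrict_space_iff) auto
  then have "AE y in lebesgue. y \<notin> T \<inter> {-pi<..<pi}" by eventually_elim (auto simp: T_def)
  then have "T \<inter> {-pi<..<pi} \<in> null_sets lebesgue"
    using opn by (subst AE_iff_null_sets) auto
  then have "negligible (T \<inter> {-pi<..<pi})" by (simp add: negligible_iff_null_sets)
  then show False using open_not_negligible[OF open_Int[OF opn open_greaterThanLessThan] ne] by blast
qed

section \<open>The Cole-Hopf potential of admissible data\<close>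

context mesh
begin

lemma hat_bounded: "\<bar>hat m x j y\<bar> \<le> 2"
proof -
  define i where "i = cell m x y"
  define r where "r = (y - e i) / (e (i + 1) - e i)"
  have r: "\<bar>r\<bar> \<le> 1" using cell_bounds[of y] by (auto simp: r_def i_def)
  define a b where "a = (if i mod int m = int j then 1 else 0 :: real)"
    and "b = (if (i + 1) mod int m = int j then 1 else 0 :: real)"
  have "hat m x j y = a + (b - a) * r"
    by (simp add: hat_def pl_function_def Let_def i_def r_def a_def b_def)
  moreover have "\<bar>a\<bar> \<le> 1" "\<bar>b - a\<bar> \<le> 1" by (auto simp: a_def b_def)
  moreover have "\<bar>(b - a) * r\<bar> \<le> 1 * 1" unfolding abs_mult using calculation(3) r by (intro mult_mono) auto
  ultimately show ?thesis by simp
qed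

lemma from_nodal_values_pl:
  "from_nodal_values m x U = pl_function m x (\<lambda>i. vec_index U (nat (i mod int m)))"
proof
  fix y
  define i where "i = cell m x y"
  define r where "r = (y - e i) / (e (i + 1) - e i)"
  have pick: "(\<Sum>j<m. vec_index U j * (if k mod int m = int j then 1 else 0)) = vec_index U (nat (k mod int m))" for k
  proof -
    have r: "nat (k mod int m) < m" "k mod int m = int (nat (k mod int m))" using mod_index[of k] m_pos by auto
    have "(\<Sum>j<m. vec_index U j * (if k mod int m = int j then 1 else 0)) = (\<Sum>j<m. if nat (k mod int m) = j then vec_index U j else 0)"
      using r(2) by (intro sum.cong) auto
    then show ?thesis using r by simp
  qed
  have affine: "u * (a + (b - a) * z / d) = u * a + (u * b - u * a) * (z / d)" for u a b z d :: real
    by (simp add: algebra_simps add_divide_distrib diff_divide_distrib)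
  have "from_nodal_values m x U y = (\<Sum>j<m. vec_index U j * (if i mod int m = int j then 1 else 0)
      + (vec_index U j * (if (i + 1) mod int m = int j then 1 else 0) - vec_index U j * (if i mod int m = int j then 1 else 0)) * r)"
    unfolding from_nodal_values_def hat_def pl_function_def Let_def i_def[symmetric]
    by (simp only: affine r_def)
  also have "\<dots> = pl_function m x (\<lambda>i. vec_index U (nat (i mod int m))) y"
    unfolding sum.distrib sum_distrib_right[symmetric] sum_subtractf pick
    by (simp add: pl_function_def Let_def i_def r_def)
  finally show "from_nodal_values m x U y = \<dots>" .
qed

lemma cell_period: "cell m x (y + 2 * pi) = cell m x y + int m"
proof (rule cell_eqI)
  have "e (cell m x y + int m) = e (cell m x y) + 2 * pi" "e (cell m x y + int m + 1) = e (cell m x y + 1) + 2 * pi"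
    using e_period[of "cell m x y" 1] e_period[of "cell m x y + 1" 1] by (simp_all add: algebra_simps)
  then show "e (cell m x y + int m) \<le> y + 2 * pi" "y + 2 * pi < e (cell m x y + int m + 1)"
    using cell_bounds[of y] by auto
qed

lemma pl_function_periodic:
  assumes "\<And>i. c (i + int m) = c i"
  shows "pl_function m x c (y + 2 * pi) = pl_function m x c y"
proof -
  have "e (i + int m) = e i + 2 * pi" for i using e_period[of i 1] by simp
  from this[of "cell m x y"] this[of "cell m x y + 1"] assms[of "cell m x y"] assms[of "cell m x y + 1"]
  show ?thesis unfolding pl_function_def Let_def cell_period by (simp add: algebra_simps)
qed

end

locale burgers_data = mesh +
  fixes \<kappa> M0 M1 :: real and u0 :: "real \<Rightarrow> real"
  assumes \<kappa>: "\<kappa> > 0" and M0: "M0 > 0" and M1: "M1 > 0"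
    and u0: "u0 \<in> pl_data M0 M1 m x"
begin

abbreviation c :: "int \<Rightarrow> real" where "c i \<equiv> u0 (x (nat (i mod int m)))"

definition slope :: "int \<Rightarrow> real" where "slope i = (c (i + 1) - c i) / (e (i + 1) - e i)"

lemma u0_from: "u0 = from_nodal_values m x (nodal_values m x u0)"
  using u0 by (simp add: pl_data_def)

lemma u0_pl: "u0 = pl_function m x c"
proof -
  have "u0 = pl_function m x (\<lambda>i. vec_index (nodal_values m x u0) (nat (i mod int m)))"
    using u0_from from_nodal_values_pl by simp
  also have "(\<lambda>i. vec_index (nodal_values m x u0) (nat (i mod int m))) = c"
  proof
    fix i
    have "nat (i mod int m) < m" using mod_index[of i] by auto
    then show "vec_index (nodal_values m x u0) (nat (i mod int m)) = c i" by (simp add: nodal_values_def)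
  qed
  finally show ?thesis .
qed

lemma u0_periodic: "u0 (y + 2 * pi) = u0 y"
  by (subst (1 2) u0_pl, rule pl_function_periodic) simp

lemma u0_cell: "e i \<le> y \<Longrightarrow> y \<le> e (i + 1) \<Longrightarrow> u0 y = c i + slope i * (y - e i)"
  by (subst u0_pl, subst pl_function_closed_cell) (auto simp: slope_def)

text \<open>By periodicity the cell may be taken inside the fundamental period; shrinking it by a quarter on both
  sides keeps it away from the endpoints \<open>- pi\<close> and \<open>pi\<close>, as test functions require.\<close>

lemma slope_bound: "\<bar>slope i\<bar> \<le> M1"
proof -
  define j where "j = nat (i mod int m)"
  have j: "j < m" "i = int j + int m * (i div int m)" using mod_index[of i] m_pos by (auto simp: j_def)
  have "slope i = slope (int j)"
  proof -
    have 1: "e i = e (int j) + 2 * pi * of_int (i div int m)"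
      using e_period[of "int j" "i div int m"] j(2) by simp
    have "i + 1 = (int j + 1) + int m * (i div int m)" using j(2) by simp
    then have 2: "e (i + 1) = e (int j + 1) + 2 * pi * of_int (i div int m)" "(i + 1) mod int m = (int j + 1) mod int m"
      using e_period[of "int j + 1" "i div int m"] by (metis, metis mod_mult_self2)
    have 3: "i mod int m = int j mod int m" using j by (metis mod_mult_self2)
    show ?thesis unfolding slope_def 1 2 3 by simp
  qed
  also have "\<bar>slope (int j)\<bar> \<le> M1"
  proof -
    define a b where "a = e (int j)" and "b = e (int j + 1)"
    have ab: "a < b" using e_less_Suc by (simp add: a_def b_def)
    have "e 0 \<le> a" "b \<le> e (int m)" unfolding a_def b_def using j by (intro e_mono; simp)+
    moreover have "e 0 = - pi" "e (int m) = pi" using e_period[of 0 1] e_nat[of 0] m_pos x_first by auto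
    ultimately have pi: "- pi \<le> a" "b \<le> pi" by auto
    obtain g where g: "g \<in> Linf" "weak_derivative u0 g" "Linf_norm g \<le> ereal M1"
      using u0 by (auto simp: pl_data_def data_class_def)
    show ?thesis
    proof (rule weak_derivative_bound_slope[OF g(2) g(1) g(3), where a = "(3 * a + b) / 4" and b = "(a + 3 * b) / 4"])
      show "u0 y = (c (int j) - slope (int j) * e (int j)) + slope (int j) * y"
        if "(3 * a + b) / 4 \<le> y" "y \<le> (a + 3 * b) / 4" for y
        using u0_cell[of "int j" y] that ab by (auto simp: a_def b_def algebra_simps)
    qed (use ab pi in \<open>auto simp: field_simps\<close>)
  qed
  finally show ?thesis .
qed

lemma u0_lipschitz: "\<bar>u0 a - u0 b\<bar> \<le> M1 * \<bar>a - b\<bar>"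
proof (rule lipschitz_of_cells)
  fix i a b assume ab: "e i \<le> a" "a \<le> b" "b \<le> e (i + 1)"
  have "u0 a - u0 b = slope i * (a - b)"
    using u0_cell[of i a] u0_cell[of i b] ab by (simp add: algebra_simps)
  then show "\<bar>u0 a - u0 b\<bar> \<le> M1 * (b - a)"
    using slope_bound[of i] ab by (auto simp: abs_mult intro!: mult_mono)
qed

lemma u0_continuous: "continuous_on UNIV u0"
proof -
  have "M1-lipschitz_on UNIV u0" using u0_lipschitz M1 by (intro lipschitz_onI) (auto simp: dist_real_def)
  then show ?thesis by (rule lipschitz_on_continuous_on)
qed

lemma u0_bound: "\<bar>u0 y\<bar> \<le> M0"
proof (rule continuous_bound_of_AE[OF u0_continuous u0_periodic])
  have "u0 \<in> Linf" "Linf_norm u0 \<le> ereal M0"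
    using u0 by (auto simp: pl_data_def data_class_def W1inf_def)
  then show "AE y in period_measure. \<bar>u0 y\<bar> \<le> M0" by (rule Linf_AE)
qed

lemma u0_measurable [measurable]: "u0 \<in> borel_measurable borel"
  by (rule borel_measurable_continuous_onI[OF u0_continuous])

text \<open>The antiderivative of \<open>u0\<close> on the whole line. As \<open>u0\<close> has mean zero it is periodic, so it agrees with
  the integral over \<open>{- pi..wrap y}\<close> in the definition of \<open>v0\<close>, and \<open>v0\<close> has no jumps at the period
  boundaries.\<close>

definition Q :: "real \<Rightarrow> real" where
  "Q = (SOME Q. (\<forall>y. (Q has_real_derivative u0 y) (at y)) \<and> Q (- pi) = 0)"

lemma Q: "(Q has_real_derivative u0 y) (at y)" and Q_pi: "Q (- pi) = 0"
proof -
  have "\<And>y. isCont u0 y" using u0_continuous by (simp add: continuous_on_eq_continuous_at)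
  then obtain F where F: "\<And>y. (F has_real_derivative u0 y) (at y)"
    using einterval_antiderivative[of "- \<infinity>" "\<infinity>" u0] by (auto simp: has_real_derivative_iff_has_vector_derivative)
  have "(\<forall>y. (Q has_real_derivative u0 y) (at y)) \<and> Q (- pi) = 0"
    unfolding Q_def by (rule someI[of _ "\<lambda>y. F y - F (- pi)"]) (auto intro!: derivative_eq_intros F)
  then show "(Q has_real_derivative u0 y) (at y)" "Q (- pi) = 0" by auto
qed

lemma Q_integral: "- pi \<le> y \<Longrightarrow> (LINT s:{- pi..y}|lborel. u0 s) = Q y"
  using integral_FTC_Icc_real[of "- pi" y Q u0] Q Q_pi u0_continuous
  by (simp add: set_lebesgue_integral_def continuous_on_eq_continuous_at mult.commute)

lemma Q_periodic: "Q (y + 2 * pi) = Q y"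
proof -
  have "((\<lambda>y. Q (y + 2 * pi) - Q y) has_real_derivative 0) (at y)" for y
  proof -
    have "((\<lambda>y. Q (y + 2 * pi)) has_real_derivative u0 (y + 2 * pi)) (at y)"
      using DERIV_shift[of Q "u0 (y + 2 * pi)" y "2 * pi"] Q by blast
    from DERIV_diff[OF this Q[of y]] show ?thesis by (simp add: u0_periodic)
  qed
  then have "Q (y + 2 * pi) - Q y = Q (- pi + 2 * pi) - Q (- pi)" by (rule DERIV_isconst_all[rule_format])
  also have "Q (- pi + 2 * pi) = 0"
  proof -
    have "(LINT s|period_measure. u0 s) = 0" using u0 by (simp add: pl_data_def data_class_def)
    then have "(LINT s:{- pi..pi}|lborel. u0 s) = 0"
      using period_measure_integral[OF u0_measurable] by (simp add: set_lebesgue_integral_def mult.commute)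
    then show ?thesis using Q_integral[of pi] by simp
  qed
  finally show ?thesis by (simp add: Q_pi)
qed

lemma Q_wrap: "Q (wrap y) = Q y"
  by (rule periodic_wrap[where w = Q, OF Q_periodic])

abbreviation v where "v \<equiv> v0 \<kappa> u0"

lemma v_eq: "v y = exp (- (Q y / (2 * \<kappa>)))"
  using Q_integral[OF wrap_bounds(1)[of y]] by (simp add: v0_def Q_wrap)

lemma Q_bound: "\<bar>Q y\<bar> \<le> 2 * pi * M0"
proof -
  have "\<bar>Q (wrap y) - Q (- pi)\<bar> \<le> M0 * \<bar>wrap y - (- pi)\<bar>"
    using field_differentiable_bound[of UNIV Q u0 M0 "wrap y" "- pi"] Q u0_bound by simp
  also have "\<dots> \<le> M0 * (2 * pi)" using wrap_bounds[of y] M0 by (intro mult_left_mono) auto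
  finally show ?thesis by (simp add: Q_wrap Q_pi mult_ac)
qed

text \<open>Lower and upper bounds \<open>cv\<close> and \<open>Cv\<close> for \<open>v\<close>, and Lipschitz constants \<open>L1\<close> of \<open>v\<close> and \<open>W\<close> of
  \<open>u0 * v\<close>. They depend on \<open>\<kappa>\<close>, \<open>M0\<close> and \<open>M1\<close> only.\<close>

definition cv where "cv = exp (- (pi * M0 / \<kappa>))"
definition Cv where "Cv = exp (pi * M0 / \<kappa>)"
definition L1 where "L1 = M0 * Cv / (2 * \<kappa>)"
definition W where "W = M1 * Cv + M0 * L1"

lemma v_bounds: "cv \<le> v y" "v y \<le> Cv" "0 < v y" and cv: "0 < cv" and Cv: "0 < Cv"
proof -
  have "- (pi * M0 / \<kappa>) \<le> Q y / (2 * \<kappa>)" "Q y / (2 * \<kappa>) \<le> pi * M0 / \<kappa>"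
    using Q_bound[of y] \<kappa> by (auto simp: abs_le_iff field_simps)
  then show "cv \<le> v y" "v y \<le> Cv" "0 < v y" by (auto simp: v_eq cv_def Cv_def)
qed (auto simp: cv_def Cv_def)

lemma v_deriv: "(v has_real_derivative - (1 / (2 * \<kappa>)) * (u0 y * v y)) (at y)"
proof -
  have "v = (\<lambda>y. exp (- (Q y / (2 * \<kappa>))))" using v_eq by auto
  then show ?thesis using \<kappa> by (auto intro!: derivative_eq_intros Q simp: field_simps)
qed

lemma v_periodic: "v (y + 2 * pi) = v y" by (simp add: v_eq Q_periodic)

lemma v_continuous: "continuous_on UNIV v"
  using v_deriv DERIV_isCont by (auto simp: continuous_on_eq_continuous_at)

lemma v_measurable [measurable]: "v \<in> borel_measurable borel"
  by (rule borel_measurable_continuous_onI[OF v_continuous])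

sublocale v: bounded_data v Cv
proof
  show "\<bar>v y\<bar> \<le> Cv" for y using v_bounds[of y] by simp
qed simp

lemma uv_bound: "\<bar>u0 y * v y\<bar> \<le> M0 * Cv"
  unfolding abs_mult using u0_bound[of y] v_bounds[of y] by (intro mult_mono) auto

sublocale uv: bounded_data "\<lambda>y. u0 y * v y" "M0 * Cv"
  using uv_bound by unfold_locales auto

lemma v_lipschitz: "\<bar>v a - v b\<bar> \<le> L1 * \<bar>a - b\<bar>"
proof -
  have "\<bar>- (1 / (2 * \<kappa>)) * (u0 y * v y)\<bar> \<le> L1" for y
    using uv_bound[of y] \<kappa> unfolding L1_def by (simp add: abs_mult divide_right_mono)
  then show ?thesis using field_differentiable_bound[of UNIV v "\<lambda>y. - (1 / (2 * \<kappa>)) * (u0 y * v y)" L1 a b] v_deriv by simp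
qed

lemma uv_lipschitz: "\<bar>u0 a * v a - u0 b * v b\<bar> \<le> W * \<bar>a - b\<bar>"
proof -
  have "\<bar>u0 a * v a - u0 b * v b\<bar> = \<bar>(u0 a - u0 b) * v a + u0 b * (v a - v b)\<bar>" by (simp add: algebra_simps)
  also have "\<dots> \<le> \<bar>(u0 a - u0 b) * v a\<bar> + \<bar>u0 b * (v a - v b)\<bar>" by (rule abs_triangle_ineq)
  also have "\<dots> \<le> (M1 * \<bar>a - b\<bar>) * Cv + M0 * (L1 * \<bar>a - b\<bar>)" unfolding abs_mult
    using u0_lipschitz[of a b] v_bounds[of a] u0_bound[of b] v_lipschitz[of a b] M0 M1
    by (intro add_mono mult_mono) auto
  finally show ?thesis by (simp add: W_def algebra_simps)
qed

lemma L1: "L1 > 0" and W: "W > 0"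
  using M0 M1 \<kappa> Cv by (auto simp: L1_def W_def intro!: add_pos_pos mult_pos_pos divide_pos_pos)

lemma interp0_error:
  assumes "\<And>a b. \<bar>f a - f b\<bar> \<le> L * \<bar>a - b\<bar>" "L \<ge> 0"
  shows "\<bar>f y - interp0 m x f y\<bar> \<le> L * h"
proof -
  have "\<bar>f y - interp0 m x f y\<bar> \<le> L * \<bar>y - e (cell m x y)\<bar>" unfolding interp0_def by (rule assms)
  also have "\<dots> \<le> L * h" using cell_bounds[of y] e_step[of "cell m x y"] assms(2) by (intro mult_left_mono) auto
  finally show ?thesis .
qed

text \<open>On a cell, \<open>v'\<close> varies by at most \<open>W / (2 * \<kappa>) * h\<close>, and by the mean value theorem the slope of the
  interpolant is one of its values.\<close>

lemma interp1_error:
  defines "d \<equiv> \<lambda>y. v y - interp1 m x v y"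
  shows "\<bar>d a - d b\<bar> \<le> (W / (2 * \<kappa>) * h) * \<bar>a - b\<bar>"
proof (rule lipschitz_of_cells)
  fix i a b assume ab: "e i \<le> a" "a \<le> b" "b \<le> e (i + 1)"
  define p where "p = (v (e (i + 1)) - v (e i)) / (e (i + 1) - e i)"
  define v' where "v' = (\<lambda>y. - (1 / (2 * \<kappa>)) * (u0 y * v y))"
  obtain \<zeta> where \<zeta>: "e i < \<zeta>" "\<zeta> < e (i + 1)" "p = v' \<zeta>"
    using MVT2[OF e_less_Suc[of i], of v v'] v_deriv e_less_Suc[of i] by (auto simp: p_def v'_def field_simps)
  show "\<bar>d a - d b\<bar> \<le> (W / (2 * \<kappa>) * h) * (b - a)"
  proof (cases "a = b")
    case False
    then have lt: "a < b" using ab by simp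
    obtain \<eta> where \<eta>: "a < \<eta>" "\<eta> < b" "v b - v a = (b - a) * v' \<eta>"
      using MVT2[OF lt, of v v'] v_deriv by (auto simp: v'_def)
    have i1: "interp1 m x v y = v (e i) + p * (y - e i)" if "e i \<le> y" "y \<le> e (i + 1)" for y
      using pl_function_closed_cell[OF that] by (simp add: interp1_def p_def)
    have "d b - d a = (b - a) * (v' \<eta> - v' \<zeta>)"
      unfolding d_def using i1[of a] i1[of b] ab lt \<eta>(3) \<zeta>(3) by (simp add: algebra_simps)
    moreover have "\<bar>v' \<eta> - v' \<zeta>\<bar> \<le> W / (2 * \<kappa>) * h"
    proof -
      have "v' \<eta> - v' \<zeta> = (u0 \<zeta> * v \<zeta> - u0 \<eta> * v \<eta>) / (2 * \<kappa>)"
        using \<kappa> by (simp add: v'_def field_simps)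
      then have "\<bar>v' \<eta> - v' \<zeta>\<bar> \<le> W * \<bar>\<zeta> - \<eta>\<bar> / (2 * \<kappa>)"
        using uv_lipschitz[of \<zeta> \<eta>] \<kappa> by (simp add: abs_divide divide_right_mono)
      also have "\<dots> \<le> W * h / (2 * \<kappa>)"
        using \<zeta> \<eta> ab e_step[of i] W \<kappa> by (intro divide_right_mono mult_left_mono) (auto simp: abs_if)
      finally show ?thesis by simp
    qed
    moreover have "\<bar>(b - a) * (v' \<eta> - v' \<zeta>)\<bar> = (b - a) * \<bar>v' \<eta> - v' \<zeta>\<bar>" using lt by (simp add: abs_mult)
    ultimately have "\<bar>d b - d a\<bar> \<le> (b - a) * (W / (2 * \<kappa>) * h)"
      using lt by (metis mult_left_mono diff_ge_0_iff_ge less_imp_le)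
    then show ?thesis by (simp add: abs_minus_commute mult_ac)
  qed simp
qed

end

section \<open>Piecewise linear interpolation by ReLU blocks\<close>

text \<open>The continuous function that is affine between the nodes \<open>k * \<delta>\<close> for \<open>k \<le> n\<close>, agrees with \<open>f\<close> at them
  and is constant outside \<open>[0, n * \<delta>]\<close>. The summands are increments over single steps, which makes
  the error estimate a telescoping argument.\<close>

definition relu_interpolant :: "(real \<Rightarrow> real) \<Rightarrow> real \<Rightarrow> nat \<Rightarrow> real \<Rightarrow> real" where
  "relu_interpolant f \<delta> n z = f 0 + (\<Sum>k<n. (f (real (Suc k) * \<delta>) - f (real k * \<delta>)) / \<delta> * (relu (z - real k * \<delta>) - relu (z - real (Suc k) * \<delta>)))"

text \<open>The coefficients after summation by parts, when each ReLU occurs once: differences of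
  successive slopes, with slope 0 outside the grid.\<close>

definition relu_coeff :: "(real \<Rightarrow> real) \<Rightarrow> real \<Rightarrow> nat \<Rightarrow> nat \<Rightarrow> real" where
  "relu_coeff f \<delta> n k = (if k < n then (f (real (Suc k) * \<delta>) - f (real k * \<delta>)) / \<delta> else 0) -
     (if k = 0 then 0 else (f (real k * \<delta>) - f (real (k - 1) * \<delta>)) / \<delta>)"

lemma relu_interpolant_coeff:
  "relu_interpolant f \<delta> n z = f 0 + (\<Sum>k<Suc n. relu_coeff f \<delta> n k * relu (z - real k * \<delta>))"
proof -
  define s where "s = (\<lambda>k. (f (real (Suc k) * \<delta>) - f (real k * \<delta>)) / \<delta>)"
  define r where "r = (\<lambda>k::nat. relu (z - real k * \<delta>))"
  have "(\<Sum>k<Suc n. relu_coeff f \<delta> n k * r k) =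
      (\<Sum>k<Suc n. (if k < n then s k else 0) * r k) - (\<Sum>k<Suc n. (if k = 0 then 0 else s (k - 1)) * r k)"
    unfolding sum_subtractf[symmetric]
    by (intro sum.cong refl) (auto simp: relu_coeff_def s_def algebra_simps)
  also have "(\<Sum>k<Suc n. (if k < n then s k else 0) * r k) = (\<Sum>k<n. s k * r k)" by simp
  also have "(\<Sum>k<Suc n. (if k = 0 then 0 else s (k - 1)) * r k) = (\<Sum>k<n. s k * r (Suc k))"
    by (subst sum.lessThan_Suc_shift) simp
  finally show ?thesis
    by (simp add: relu_interpolant_def r_def s_def sum_subtractf right_diff_distrib)
qed

text \<open>The interpolant is \<open>L\<close>-Lipschitz on the whole line, so an inaccurate argument \<open>z\<close>, even one outside
  \<open>[0, B]\<close>, costs at most \<open>L * \<bar>z - y\<bar>\<close>; at \<open>y\<close> itself both functions are within \<open>L * B / n\<close> of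
  their common value at the node to the left.\<close>

lemma relu_interpolant_error:
  assumes n: "n \<ge> 1" and B: "B > 0" and L: "L \<ge> 0" and y: "y \<in> {0..B}"
    and lip: "\<And>a b. a \<in> {0..B} \<Longrightarrow> b \<in> {0..B} \<Longrightarrow> \<bar>f a - f b\<bar> \<le> L * \<bar>a - b\<bar>"
  shows "\<bar>relu_interpolant f (B / real n) n z - f y\<bar> \<le> L * \<bar>z - y\<bar> + 2 * L * B / real n"
proof -
  define \<delta> where "\<delta> = B / real n"
  have \<delta>: "\<delta> > 0" "real n * \<delta> = B" using n B by (auto simp: \<delta>_def)
  define D where "D = (\<lambda>k. f (real (Suc k) * \<delta>) - f (real k * \<delta>))"
  define T where "T = (\<lambda>k z. relu (z - real k * \<delta>) - relu (z - real (Suc k) * \<delta>))"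
  have P: "relu_interpolant f \<delta> n z = f 0 + (\<Sum>k<n. D k / \<delta> * T k z)" for z
    by (simp add: relu_interpolant_def D_def T_def)
  have node: "real k * \<delta> \<in> {0..B}" if "k \<le> n" for k
    using that \<delta> by (auto simp flip: \<delta>(2) intro!: mult_right_mono)
  have D: "\<bar>D k\<bar> \<le> L * \<delta>" if "k < n" for k
    using lip[OF node[of "Suc k"] node[of k]] that \<delta> by (simp add: D_def algebra_simps)
  have lipP: "\<bar>relu_interpolant f \<delta> n a - relu_interpolant f \<delta> n b\<bar> \<le> L * (b - a)" if "a \<le> b" for a b
  proof -
    have mono: "T k a \<le> T k b" for k using that \<delta> by (auto simp: T_def relu_def max_def algebra_simps)
    have "relu_interpolant f \<delta> n b - relu_interpolant f \<delta> n a = (\<Sum>k<n. D k / \<delta> * (T k b - T k a))"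
      unfolding P by (simp add: sum_subtractf right_diff_distrib)
    also have "\<bar>\<dots>\<bar> \<le> (\<Sum>k<n. L * (T k b - T k a))"
    proof (rule order_trans[OF sum_abs], rule sum_mono)
      fix k assume "k \<in> {..<n}"
      then have "\<bar>D k / \<delta>\<bar> \<le> L" using D[of k] \<delta> by (simp add: abs_divide divide_le_eq)
      then show "\<bar>D k / \<delta> * (T k b - T k a)\<bar> \<le> L * (T k b - T k a)"
        unfolding abs_mult[of "D k / \<delta>"] using mono[of k] L by (intro mult_mono) auto
    qed
    also have "\<dots> = L * ((relu b - relu (b - real n * \<delta>)) - (relu a - relu (a - real n * \<delta>)))"
    proof -
      have "(\<Sum>k<n. T k z) = relu z - relu (z - real n * \<delta>)" for z
        unfolding T_def using sum_lessThan_telescope'[of "\<lambda>k. relu (z - real k * \<delta>)" n] by simp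
      then show ?thesis by (simp add: sum_distrib_left[symmetric] sum_subtractf)
    qed
    also have "\<dots> \<le> L * (b - a)" using L that \<delta> B by (intro mult_left_mono) (auto simp: relu_def max_def)
    finally show ?thesis by (simp add: abs_minus_commute)
  qed
  have "\<bar>relu_interpolant f \<delta> n z - relu_interpolant f \<delta> n y\<bar> \<le> L * \<bar>z - y\<bar>"
    using lipP[of z y] lipP[of y z] by (cases "z \<le> y") (auto simp: abs_minus_commute)
  moreover have "\<bar>relu_interpolant f \<delta> n y - f y\<bar> \<le> 2 * L * \<delta>"
  proof -
    have "\<exists>k<n. real k * \<delta> \<le> y \<and> y \<le> real (Suc k) * \<delta>"
    proof -
      have ex: "y \<le> real j * \<delta> \<Longrightarrow> j \<le> n \<Longrightarrow> j \<ge> 1 \<Longrightarrow> \<exists>k<n. real k * \<delta> \<le> y \<and> y \<le> real (Suc k) * \<delta>" for j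
      proof (induction j)
        case (Suc j)
        show ?case
        proof (cases "y \<le> real j * \<delta> \<and> j \<ge> 1")
          case False
          then show ?thesis using Suc.prems y by (intro exI[of _ j]) (cases j; auto)
        qed (use Suc in auto)
      qed simp
      show ?thesis using ex[of n] y \<delta> n by auto
    qed
    then obtain k where k: "k < n" "real k * \<delta> \<le> y" "y \<le> real (Suc k) * \<delta>" by blast
    have mono: "real i * \<delta> \<le> real j * \<delta>" if "i \<le> j" for i j using that \<delta> by (intro mult_right_mono) auto
    have below: "T j y = \<delta>" if "j < k" for j
      using mono[of "Suc j" k] that k(2) \<delta> by (auto simp: T_def relu_def max_def algebra_simps)
    have above: "T j y = 0" if "k < j" for j
    proof -
      have "y \<le> real j * \<delta>" using mono[of "Suc k" j] that k(3) by simp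
      moreover from this have "y \<le> real (Suc j) * \<delta>" using mono[of j "Suc j"] by simp
      ultimately show ?thesis by (simp add: T_def relu_def del: of_nat_Suc)
    qed
    have "(\<Sum>j<n. D j / \<delta> * T j y) = (\<Sum>j<Suc k. D j / \<delta> * T j y)"
      using k(1) above by (intro sum.mono_neutral_right) auto
    also have "\<dots> = (\<Sum>j<k. D j) + D k / \<delta> * T k y" using below \<delta> by simp
    also have "(\<Sum>j<k. D j) = f (real k * \<delta>) - f 0"
      unfolding D_def using sum_lessThan_telescope[of "\<lambda>j. f (real j * \<delta>)" k] by simp
    finally have "relu_interpolant f \<delta> n y - f y = (f (real k * \<delta>) - f y) + D k * (T k y / \<delta>)" by (simp add: P)
    also have "\<bar>\<dots>\<bar> \<le> L * \<delta> + (L * \<delta>) * 1"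
    proof (rule order_trans[OF abs_triangle_ineq], rule add_mono)
      have "\<bar>f (real k * \<delta>) - f y\<bar> \<le> L * \<bar>real k * \<delta> - y\<bar>" using node[of k] k y by (intro lip) auto
      also have "\<dots> \<le> L * \<delta>" using k L by (intro mult_left_mono) (auto simp: algebra_simps)
      finally show "\<bar>f (real k * \<delta>) - f y\<bar> \<le> L * \<delta>" .
      have "0 \<le> T k y" "T k y \<le> \<delta>" using k \<delta> by (auto simp: T_def relu_def max_def algebra_simps)
      then show "\<bar>D k * (T k y / \<delta>)\<bar> \<le> (L * \<delta>) * 1"
        unfolding abs_mult using D[OF k(1)] \<delta> L by (intro mult_mono) (auto simp: divide_le_eq)
    qed
    finally show ?thesis by simp
  qed
  ultimately show ?thesis unfolding \<delta>_def by (simp add: abs_if split: if_splits)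
qed

text \<open>Concatenation composes networks with an additional activation in between. That activation is harmless
  wherever the intended intermediate values are nonnegative.\<close>

lemma relu_net_append:
  assumes "A \<noteq> []" "B \<noteq> []"
  shows "relu_net (A @ B) z = relu_net B (map_vec relu (relu_net A z))"
  using assms
proof (induction A z rule: relu_net.induct)
  case (2 W b z)
  then show ?case by (cases B) auto
qed auto

lemma has_architecture_append:
  assumes "has_architecture (ds @ [k]) A" "has_architecture (k # ds') B"
  shows "has_architecture (ds @ k # ds') (A @ B)"
proof -
  have l: "length ds = length A" "length ds' = length B" using assms by (auto simp: has_architecture_def)
  show ?thesis unfolding has_architecture_def
  proof (intro conjI allI impI)
    show "length (ds @ k # ds') = Suc (length (A @ B))" using l by simp
    fix i assume i: "i < length (A @ B)"
    have "fst ((A @ B) ! i) \<in> carrier_mat ((ds @ k # ds') ! Suc i) ((ds @ k # ds') ! i) \<and> snd ((A @ B) ! i) \<in> carrier_vec ((ds @ k # ds') ! Suc i)"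
    proof (cases "i < length A")
      case True
      then have "(ds @ k # ds') ! i = (ds @ [k]) ! i" "(ds @ k # ds') ! Suc i = (ds @ [k]) ! Suc i"
        using l by (auto simp: nth_append)
      then show ?thesis using True assms(1) by (auto simp: has_architecture_def nth_append)
    next
      case False
      define j where "j = i - length A"
      have j: "i = length A + j" "j < length B" using False i by (auto simp: j_def)
      then show ?thesis using l assms(2) by (auto simp: has_architecture_def nth_append)
    qed
    then show "fst ((A @ B) ! i) \<in> carrier_mat ((ds @ k # ds') ! Suc i) ((ds @ k # ds') ! i)"
      "snd ((A @ B) ! i) \<in> carrier_vec ((ds @ k # ds') ! Suc i)" by auto
  qed
qed

lemma net_size_append: "net_size (A @ B) = net_size A + net_size B"
  by (simp add: net_size_def)

lemma layer_size_le_support: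
  assumes "finite S" "{(i, j). i < dim_row W \<and> j < dim_col W \<and> W $$ (i, j) \<noteq> 0} \<subseteq> S"
  shows "layer_size (W, b) \<le> card S + dim_vec b"
proof -
  have "card {(i, j). i < dim_row W \<and> j < dim_col W \<and> W $$ (i, j) \<noteq> 0} \<le> card S"
    using assms by (intro card_mono)
  moreover have "card {i. i < dim_vec b \<and> vec_index b i \<noteq> 0} \<le> card {..<dim_vec b}"
    by (intro card_mono) auto
  ultimately show ?thesis by (simp add: layer_size_def)
qed

lemma sum_div_mod:
  assumes "N > 0"
  shows "(\<Sum>q<d * N. g (q div N) (q mod N)) = (\<Sum>i<d. \<Sum>k<N. g i (k::nat) :: real)"
proof -
  have "(\<Sum>q<d * N. g (q div N) (q mod N)) = (\<Sum>i<d. \<Sum>q=i * N..<i * N + N. g (q div N) (q mod N))"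
    by (rule sum.nat_group[symmetric])
  also have "\<dots> = (\<Sum>i<d. \<Sum>k<N. g i k)"
  proof (rule sum.cong[OF refl])
    fix i
    have "(\<Sum>q=i * N..<i * N + N. g (q div N) (q mod N)) = (\<Sum>k=0..<N. g ((k + i * N) div N) ((k + i * N) mod N))"
      using sum.shift_bounds_nat_ivl[of "\<lambda>q. g (q div N) (q mod N)" 0 "i * N" N] by (simp add: add.commute)
    also have "\<dots> = (\<Sum>k=0..<N. g i k)" using assms by (intro sum.cong refl) auto
    finally show "(\<Sum>q=i * N..<i * N + N. g (q div N) (q mod N)) = (\<Sum>k<N. g i k)" by (simp add: lessThan_atLeast0)
  qed
  finally show ?thesis .
qed

text \<open>Three layers for the componentwise maps \<open>f i\<close> applied to the affine map given by \<open>A\<close> and \<open>b\<close>: the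
  affine map, the \<open>n + 1\<close> shifts of each component, and their combination by \<open>relu_coeff\<close>. Neuron
  \<open>i * Suc n + k\<close> of the second layer belongs to shift \<open>k\<close> of component \<open>i\<close>. The affine map has a layer
  of its own because otherwise each of its rows would be repeated \<open>n + 1\<close> times.\<close>

definition block :: "nat \<Rightarrow> nat \<Rightarrow> nat \<Rightarrow> real \<Rightarrow> (nat \<Rightarrow> nat \<Rightarrow> real) \<Rightarrow> (nat \<Rightarrow> real) \<Rightarrow> (nat \<Rightarrow> real \<Rightarrow> real) \<Rightarrow> params" where
  "block e d n \<delta> A b f =
    [(Matrix.mat d e (\<lambda>(i, j). A i j), Matrix.vec d b),
     (Matrix.mat (d * Suc n) d (\<lambda>(q, i). if q div Suc n = i then 1 else 0), Matrix.vec (d * Suc n) (\<lambda>q. - (real (q mod Suc n) * \<delta>))),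
     (Matrix.mat d (d * Suc n) (\<lambda>(i, q). if q div Suc n = i then relu_coeff (f i) \<delta> n (q mod Suc n) else 0), Matrix.vec d (\<lambda>i. f i 0))]"

lemma block_nonempty: "block e d n \<delta> A b f \<noteq> []" by (simp add: block_def)

lemma block_architecture: "has_architecture [e, d, d * Suc n, d] (block e d n \<delta> A b f)"
  by (auto simp: has_architecture_def block_def less_Suc_eq_0_disj simp del: mult_Suc_right)

text \<open>Each of the \<open>d * Suc n\<close> shifted neurons has one incoming weight, one bias and at most one nonzero outgoing
  weight.\<close>

lemma block_size: "net_size (block e d n \<delta> A b f) \<le> d * e + 2 * d + 3 * (d * Suc n)"
proof -
  have 1: "layer_size (Matrix.mat d e (\<lambda>(i, j). A i j), Matrix.vec d b) \<le> d * e + d"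
    using layer_size_le_support[of "{..<d} \<times> {..<e}" "Matrix.mat d e (\<lambda>(i, j). A i j)" "Matrix.vec d b"] by auto
  have c1: "card ((\<lambda>q. (q, q div Suc n)) ` {..<d * Suc n}) \<le> d * Suc n"
    using card_image_le[of "{..<d * Suc n}" "\<lambda>q. (q, q div Suc n)"] by simp
  have c2: "card ((\<lambda>q. (q div Suc n, q)) ` {..<d * Suc n}) \<le> d * Suc n"
    using card_image_le[of "{..<d * Suc n}" "\<lambda>q. (q div Suc n, q)"] by simp
  have 2: "layer_size (Matrix.mat (d * Suc n) d (\<lambda>(q, i). if q div Suc n = i then 1 else 0), Matrix.vec (d * Suc n) (\<lambda>q. - (real (q mod Suc n) * \<delta>))) \<le> d * Suc n + d * Suc n"
    by (rule order_trans[OF layer_size_le_support[of "(\<lambda>q. (q, q div Suc n)) ` {..<d * Suc n}"]])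
      (use c1 in \<open>auto split: if_splits simp del: mult_Suc_right\<close>)
  have 3: "layer_size (Matrix.mat d (d * Suc n) (\<lambda>(i, q). if q div Suc n = i then relu_coeff (f i) \<delta> n (q mod Suc n) else 0), Matrix.vec d (\<lambda>i. f i 0)) \<le> d * Suc n + d"
    by (rule order_trans[OF layer_size_le_support[of "(\<lambda>q. (q div Suc n, q)) ` {..<d * Suc n}"]])
      (use c2 in \<open>auto split: if_splits simp del: mult_Suc_right\<close>)
  show ?thesis using 1 2 3 unfolding net_size_def block_def by simp
qed

lemma block_eval:
  assumes z: "z \<in> carrier_vec e" and i: "i < d"
  shows "relu_net (block e d n \<delta> A b f) z \<in> carrier_vec d"
    and "vec_index (relu_net (block e d n \<delta> A b f) z) i =
      relu_interpolant (f i) \<delta> n (relu ((\<Sum>j<e. A i j * vec_index z j) + b i))"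
proof -
  define N where "N = Suc n"
  define y where "y = (\<lambda>i. relu ((\<Sum>j<e. A i j * vec_index z j) + b i))"
  have 1: "map_vec relu (Matrix.mat d e (\<lambda>(i, j). A i j) *\<^sub>v z + Matrix.vec d b) = Matrix.vec d y"
    using z by (intro eq_vecI) (auto simp: y_def scalar_prod_def lessThan_atLeast0)
  have 2: "map_vec relu (Matrix.mat (d * N) d (\<lambda>(q, i). if q div N = i then 1 else 0) *\<^sub>v Matrix.vec d y + Matrix.vec (d * N) (\<lambda>q. - (real (q mod N) * \<delta>)))
    = Matrix.vec (d * N) (\<lambda>q. relu (y (q div N) - real (q mod N) * \<delta>))"
  proof (intro eq_vecI)
    fix q assume "q < dim_vec (Matrix.vec (d * N) (\<lambda>q. relu (y (q div N) - real (q mod N) * \<delta>)))"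
    then have q: "q < d * N" by simp
    then have "q div N < d" by (simp add: less_mult_imp_div_less)
    have "(\<Sum>i = 0..<d. (if q div N = i then 1 else 0) * y i) = (\<Sum>i = 0..<d. if q div N = i then y i else 0)"
      by (intro sum.cong) auto
    also have "\<dots> = y (q div N)" using \<open>q div N < d\<close> by simp
    finally show "vec_index (map_vec relu (Matrix.mat (d * N) d (\<lambda>(q, i). if q div N = i then 1 else 0) *\<^sub>v Matrix.vec d y + Matrix.vec (d * N) (\<lambda>q. - (real (q mod N) * \<delta>)))) q
      = vec_index (Matrix.vec (d * N) (\<lambda>q. relu (y (q div N) - real (q mod N) * \<delta>))) q"
      using q by (simp add: scalar_prod_def)
  qed simp
  have net: "relu_net (block e d n \<delta> A b f) z = Matrix.mat d (d * N) (\<lambda>(i, q). if q div N = i then relu_coeff (f i) \<delta> n (q mod N) else 0) *\<^sub>v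
      Matrix.vec (d * N) (\<lambda>q. relu (y (q div N) - real (q mod N) * \<delta>)) + Matrix.vec d (\<lambda>i. f i 0)"
    unfolding block_def N_def[symmetric] by (simp only: relu_net.simps 1 2)
  show "relu_net (block e d n \<delta> A b f) z \<in> carrier_vec d"
    unfolding net by (rule carrier_vecI) simp
  have "vec_index (relu_net (block e d n \<delta> A b f) z) i =
     (\<Sum>q<d * N. (if q div N = i then relu_coeff (f i) \<delta> n (q mod N) else 0) * relu (y (q div N) - real (q mod N) * \<delta>)) + f i 0"
    unfolding net using i by (simp add: scalar_prod_def lessThan_atLeast0)
  also have "\<dots> = (\<Sum>l<d. \<Sum>k<N. (if l = i then relu_coeff (f i) \<delta> n k else 0) * relu (y l - real k * \<delta>)) + f i 0"
    using sum_div_mod[of N "\<lambda>l k. (if l = i then relu_coeff (f i) \<delta> n k else 0) * relu (y l - real k * \<delta>)" d] by (simp add: N_def)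
  also have "(\<Sum>l<d. \<Sum>k<N. (if l = i then relu_coeff (f i) \<delta> n k else 0) * relu (y l - real k * \<delta>)) =
     (\<Sum>l<d. if l = i then \<Sum>k<N. relu_coeff (f i) \<delta> n k * relu (y i - real k * \<delta>) else 0)"
    by (intro sum.cong) auto
  also have "\<dots> + f i 0 = relu_interpolant (f i) \<delta> n (y i)"
    using i by (simp add: relu_interpolant_coeff N_def del: sum.lessThan_Suc)
  finally show "vec_index (relu_net (block e d n \<delta> A b f) z) i =
      relu_interpolant (f i) \<delta> n (relu ((\<Sum>j<e. A i j * vec_index z j) + b i))"
    by (simp add: y_def)
qed

lemma block_error:
  assumes z: "z \<in> carrier_vec e" and i: "i < d" and n: "n \<ge> 1" and B: "B > 0" and L: "L \<ge> 0" and y: "y \<in> {0..B}"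
    and lip: "\<And>s t. s \<in> {0..B} \<Longrightarrow> t \<in> {0..B} \<Longrightarrow> \<bar>f i s - f i t\<bar> \<le> L * \<bar>s - t\<bar>"
    and near: "\<bar>(\<Sum>j<e. A i j * vec_index z j) + b i - y\<bar> \<le> \<epsilon>"
  shows "\<bar>vec_index (relu_net (block e d n (B / real n) A b f) z) i - f i y\<bar> \<le> L * \<epsilon> + 2 * L * B / real n"
proof -
  define s where "s = (\<Sum>j<e. A i j * vec_index z j) + b i"
  have "\<bar>relu s - y\<bar> \<le> \<epsilon>" using near y by (auto simp: relu_def s_def max_def abs_if split: if_splits)
  then have "L * \<bar>relu s - y\<bar> \<le> L * \<epsilon>" using L by (rule mult_left_mono)
  then show ?thesis
    using relu_interpolant_error[OF n B L y lip, of "relu s"] unfolding block_eval(2)[OF z i] s_def by simp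
qed

section \<open>A network for softmax-type weighted averages\<close>

text \<open>How an error \<open>\<epsilon>\<close> in the input propagates through a block: it is multiplied by the row sum \<open>\<rho>\<close> and by the
  Lipschitz constant, and the interpolation error is added.\<close>

lemma block_step:
  assumes z: "z \<in> carrier_vec e" and i: "i < d" and n: "n \<ge> 1" and B: "B > 0" and L: "L \<ge> 0"
    and lip: "\<And>s t. s \<in> {0..B} \<Longrightarrow> t \<in> {0..B} \<Longrightarrow> \<bar>f i s - f i t\<bar> \<le> L * \<bar>s - t\<bar>"
    and near: "\<And>k. k < e \<Longrightarrow> \<bar>vec_index z k - Y k\<bar> \<le> \<epsilon>" and \<epsilon>: "\<epsilon> \<ge> 0"
    and row: "(\<Sum>k<e. \<bar>A i k\<bar>) \<le> \<rho>"
    and y: "(\<Sum>k<e. A i k * Y k) + b i = y" "y \<in> {0..B}"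
  shows "\<bar>vec_index (relu_net (block e d n (B / real n) A b f) z) i - f i y\<bar> \<le> L * (\<rho> * \<epsilon>) + 2 * L * B / real n"
proof (rule block_error[where f = f and A = A and b = b and i = i, OF z i n B L y(2) lip])
  have "(\<Sum>k<e. A i k * vec_index z k) + b i - y = (\<Sum>k<e. A i k * (vec_index z k - Y k))"
    unfolding y(1)[symmetric] by (simp add: sum_subtractf right_diff_distrib)
  also have "\<bar>\<dots>\<bar> \<le> (\<Sum>k<e. \<bar>A i k\<bar> * \<epsilon>)"
    using near by (intro order_trans[OF sum_abs] sum_mono) (auto simp: abs_mult intro!: mult_left_mono)
  also have "\<dots> \<le> \<rho> * \<epsilon>" using row \<epsilon> by (simp add: sum_distrib_right[symmetric] mult_right_mono)
  finally show "\<bar>(\<Sum>k<e. A i k * vec_index z k) + b i - y\<bar> \<le> \<rho> * \<epsilon>" .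
qed auto

lemma relu_near: "y \<ge> 0 \<Longrightarrow> \<bar>z - y\<bar> \<le> \<epsilon> \<Longrightarrow> \<bar>relu z - y\<bar> \<le> \<epsilon>"
  by (auto simp: relu_def max_def abs_if split: if_splits)

lemma ln_max_lipschitz:
  fixes a s t :: real
  assumes "a > 0"
  shows "\<bar>ln (max a s) - ln (max a t)\<bar> \<le> 1 / a * \<bar>s - t\<bar>"
proof -
  have le: "ln x - ln y \<le> 1 / a * (x - y)" if "a \<le> y" "y \<le> x" for x y
  proof -
    have "ln x - ln y \<le> (x - y) / y" using that assms by (intro ln_diff_le) auto
    also have "\<dots> \<le> (x - y) / a" using that assms by (intro divide_left_mono) auto
    finally show ?thesis by simp
  qed
  have "\<bar>ln x - ln y\<bar> \<le> 1 / a * \<bar>x - y\<bar>" if "a \<le> y" "a \<le> x" for x y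
  proof (cases "y \<le> x")
    case True
    then have "ln y \<le> ln x" using that assms by simp
    then show ?thesis using le[OF that(1) True] True by simp
  next
    case False
    then have "ln x \<le> ln y" using that assms by simp
    then show ?thesis using le[OF that(2), of y] False by simp
  qed
  from this[of "max a t" "max a s"] have "\<bar>ln (max a s) - ln (max a t)\<bar> \<le> 1 / a * \<bar>max a s - max a t\<bar>" by simp
  also have "\<dots> \<le> 1 / a * \<bar>s - t\<bar>" using assms by (intro mult_left_mono) auto
  finally show ?thesis .
qed

lemma exp_lipschitz:
  fixes s t B :: real
  assumes "s \<le> B" "t \<le> B"
  shows "\<bar>exp s - exp t\<bar> \<le> exp B * \<bar>s - t\<bar>"
  using field_differentiable_bound[of "{..B}" exp exp "exp B" s t] assms
    DERIV_exp[THEN has_field_derivative_at_within] by auto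

lemma sum_lessThan_add: "(\<Sum>k<m + n. g k) = (\<Sum>k<m. g k) + (\<Sum>k<n. g (m + k :: nat) :: real)"
  by (induction n) auto

text \<open>Three widths for each of four blocks, less the output width; products with 1 are kept so that the
  list has the shape of \<open>block_architecture\<close>.\<close>

definition hidden_widths :: "nat \<Rightarrow> nat list" where
  "hidden_widths m = [2 * m, 2 * m * Suc m, 2 * m, 2 * m, 2 * m * Suc m, 2 * m, 2, 2 * Suc m, 2, 1, 1 * Suc m]"

text \<open>The quotient equals
  \<open>M0 * exp (ln (\<Sum>j<m. p j * exp (ln (\<rho> j) - S j)) - ln (\<Sum>j<m. p j * exp (- S j))) - 2 * M0\<close> with
  \<open>\<rho> j = (U j + 2 * M0) / M0\<close> and \<open>S j = (\<Sum>k<m. a j k * U k)\<close>. The shift by \<open>2 * M0\<close> keeps the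
  arguments of both logarithms positive: \<open>\<rho> j\<close> lies in \<open>[1, 3]\<close>. Four blocks compute, in turn, \<open>ln (\<rho> j)\<close>
  together with \<open>S j\<close>; the exponentials; the logarithms of the two sums; and the final exponential.
  Additive shifts by \<open>K\<close> make all intermediate targets nonnegative, as composition of networks
  requires. Every row sum is at most 2 and every Lipschitz constant is bounded in terms of \<open>M0\<close> and \<open>K\<close>, so the
  errors accumulate only by a constant factor.\<close>

lemma weighted_average_network:
  fixes M0 K :: real
  assumes M0: "M0 > 0" and K: "K > 0"
  obtains C where "C \<ge> 0" and
    "\<And>m (a :: nat \<Rightarrow> nat \<Rightarrow> real) p. \<lbrakk>m \<ge> 1; \<And>j. j < m \<Longrightarrow> p j \<ge> 0; (\<Sum>j<m. p j) = 1\<rbrakk> \<Longrightarrow>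
      \<exists>\<Theta>. has_architecture (m # hidden_widths m @ [1]) \<Theta> \<and> net_size \<Theta> \<le> 68 * m\<^sup>2 \<and>
        (\<forall>U\<in>carrier_vec m. (\<forall>j<m. \<bar>vec_index U j\<bar> \<le> M0) \<longrightarrow> (\<forall>j<m. \<bar>\<Sum>k<m. a j k * vec_index U k\<bar> \<le> K) \<longrightarrow>
          \<bar>vec_index (relu_net \<Theta> U) 0 -
            (\<Sum>j<m. p j * (vec_index U j * exp (- (\<Sum>k<m. a j k * vec_index U k)))) /
            (\<Sum>j<m. p j * exp (- (\<Sum>k<m. a j k * vec_index U k)))\<bar> \<le> C / real m)"
proof -
  \<comment> \<open>One interval and one Lipschitz constant serve all four blocks.\<close>
  define B where "B = 3 * M0 + 2 * K + 3 + 3 * exp K"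
  define L where "L = 1 / M0 + 1 + exp B + exp K + M0 * exp B"
  have B: "B > 0" using M0 K by (simp add: B_def add_pos_pos)
  have Bge: "3 * M0 \<le> B" "2 * K + 2 \<le> B" "3 * exp K \<le> B" "2 \<le> B"
    using M0 K exp_gt_zero[of K] unfolding B_def by linarith+
  have L: "L \<ge> 1 / M0" "L \<ge> 1" "L \<ge> exp B" "L \<ge> exp K" "L \<ge> M0 * exp B" "L \<ge> 0"
    using M0 by (auto simp: L_def intro!: add_nonneg_nonneg)
  have ln3: "ln 3 \<le> (2::real)" using ln_le_minus_one[of "3::real"] by simp
  \<comment> \<open>\<open>E i / m\<close> bounds the error after block \<open>i\<close>. The first block receives exact inputs.\<close>
  define E1 E2 E3 E4 where "E1 = 2 * L * B" and "E2 = L * (2 * E1) + 2 * L * B"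
    and "E3 = L * (1 * E2) + 2 * L * B" and "E4 = L * (2 * E3) + 2 * L * B"
  have E: "E1 \<ge> 0" "E2 \<ge> 0" "E3 \<ge> 0" "E4 \<ge> 0" using B L(6) by (auto simp: E1_def E2_def E3_def E4_def)
  \<comment> \<open>The maxima inside the logarithms are inactive at the exact arguments; they make the functions
    Lipschitz on the whole interval.\<close>
  define f1 where "f1 = (\<lambda>m i s. if i < (m::nat) then ln (max M0 s) - ln M0 else s)"
  define f2 where "f2 = (\<lambda>(i::nat) s. exp (s - K))"
  define f3 where "f3 = (\<lambda>(i::nat) s. ln (max (exp (- K)) s) + K)"
  define f4 where "f4 = (\<lambda>(i::nat) s. M0 * exp s - 2 * M0)"
  have lip1: "\<bar>f1 m i s - f1 m i t\<bar> \<le> L * \<bar>s - t\<bar>" for m i s t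
  proof (cases "i < m")
    case True
    then show ?thesis
      using order_trans[OF ln_max_lipschitz[OF M0, of s t] mult_right_mono[OF L(1), of "\<bar>s - t\<bar>"]] by (simp add: f1_def)
  next
    case False
    then show ?thesis using mult_right_mono[OF L(2), of "\<bar>s - t\<bar>"] by (simp add: f1_def)
  qed
  have lip2: "\<bar>f2 i s - f2 i t\<bar> \<le> L * \<bar>s - t\<bar>" if "s \<in> {0..B}" "t \<in> {0..B}" for i s t
  proof -
    have "\<bar>exp (s - K) - exp (t - K)\<bar> \<le> exp B * \<bar>(s - K) - (t - K)\<bar>"
      by (rule exp_lipschitz) (use that K in auto)
    also have "\<dots> \<le> L * \<bar>s - t\<bar>" using mult_right_mono[OF L(3), of "\<bar>s - t\<bar>"] by simp
    finally show ?thesis by (simp add: f2_def)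
  qed
  have lip3: "\<bar>f3 i s - f3 i t\<bar> \<le> L * \<bar>s - t\<bar>" for i s t
  proof -
    have "\<bar>ln (max (exp (- K)) s) - ln (max (exp (- K)) t)\<bar> \<le> 1 / exp (- K) * \<bar>s - t\<bar>"
      by (rule ln_max_lipschitz) simp
    also have "\<dots> \<le> L * \<bar>s - t\<bar>" using mult_right_mono[OF L(4), of "\<bar>s - t\<bar>"] by (simp add: exp_minus divide_inverse mult.commute)
    finally show ?thesis by (simp add: f3_def)
  qed
  have lip4: "\<bar>f4 i s - f4 i t\<bar> \<le> L * \<bar>s - t\<bar>" if "s \<in> {0..B}" "t \<in> {0..B}" for i s t
  proof -
    have "\<bar>f4 i s - f4 i t\<bar> = M0 * \<bar>exp s - exp t\<bar>" using M0 by (simp add: f4_def abs_mult flip: right_diff_distrib)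
    also have "\<dots> \<le> M0 * (exp B * \<bar>s - t\<bar>)" using exp_lipschitz[of s B t] that M0 by (intro mult_left_mono) auto
    also have "\<dots> \<le> L * \<bar>s - t\<bar>" using mult_right_mono[OF L(5), of "\<bar>s - t\<bar>"] by simp
    finally show ?thesis .
  qed
  show ?thesis
  proof (rule that[of E4])
    show "E4 \<ge> 0" by fact
    fix m :: nat and a :: "nat \<Rightarrow> nat \<Rightarrow> real" and p :: "nat \<Rightarrow> real"
    assume m: "m \<ge> 1" and p: "\<And>j. j < m \<Longrightarrow> p j \<ge> 0" and p1: "(\<Sum>j<m. p j) = 1"
    define \<delta> where "\<delta> = B / real m"
    define A1 where "A1 = (\<lambda>i k. if i < m then (if k = i then 1 else 0) else a (i - m) k)"
    define b1 where "b1 = (\<lambda>i. if i < m then 2 * M0 else K)"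
    define A2 where "A2 = (\<lambda>i k. if i < m then (if k = i then 1 else 0) - (if k = m + i then 1 else 0) else - (if k = i then 1 else 0 :: real))"
    define b2 where "b2 = (\<lambda>i::nat. 2 * K)"
    define A3 where "A3 = (\<lambda>i k. if i = (0::nat) then (if k < m then p k else 0) else (if k < m then 0 else p (k - m)))"
    define A4 where "A4 = (\<lambda>(i::nat) k. if k = (0::nat) then 1 else - 1 :: real)"
    define \<Theta>1 where "\<Theta>1 = block m (2 * m) m \<delta> A1 b1 (f1 m)"
    define \<Theta>2 where "\<Theta>2 = block (2 * m) (2 * m) m \<delta> A2 b2 f2"
    define \<Theta>3 where "\<Theta>3 = block (2 * m) 2 m \<delta> A3 (\<lambda>_. 0) f3"
    define \<Theta>4 where "\<Theta>4 = block 2 1 m \<delta> A4 (\<lambda>_. 0) f4"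
    define \<Theta> where "\<Theta> = \<Theta>1 @ \<Theta>2 @ \<Theta>3 @ \<Theta>4"
    note bl = \<Theta>1_def \<Theta>2_def \<Theta>3_def \<Theta>4_def
    have ne: "\<Theta>1 \<noteq> []" "\<Theta>2 \<noteq> []" "\<Theta>3 \<noteq> []" "\<Theta>4 \<noteq> []" unfolding bl by (rule block_nonempty)+
    have arch: "has_architecture (m # hidden_widths m @ [1]) \<Theta>"
    proof -
      have "has_architecture [2 * m, 2, 2 * Suc m, 2, 1, 1 * Suc m, 1] (\<Theta>3 @ \<Theta>4)"
        using has_architecture_append[of "[2 * m, 2, 2 * Suc m]" 2 \<Theta>3 "[1, 1 * Suc m, 1]" \<Theta>4]
          block_architecture[of "2 * m" 2 m \<delta> A3 _ f3] block_architecture[of 2 1 m \<delta> A4 _ f4] by (simp add: bl)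
      then have "has_architecture [2 * m, 2 * m, 2 * m * Suc m, 2 * m, 2, 2 * Suc m, 2, 1, 1 * Suc m, 1] (\<Theta>2 @ \<Theta>3 @ \<Theta>4)"
        using has_architecture_append[of "[2 * m, 2 * m, 2 * m * Suc m]" "2 * m" \<Theta>2 "[2, 2 * Suc m, 2, 1, 1 * Suc m, 1]" "\<Theta>3 @ \<Theta>4"]
          block_architecture[of "2 * m" "2 * m" m \<delta> A2 b2 f2] by (simp add: bl)
      then show ?thesis
        using has_architecture_append[of "[m, 2 * m, 2 * m * Suc m]" "2 * m" \<Theta>1 "[2 * m, 2 * m * Suc m, 2 * m, 2, 2 * Suc m, 2, 1, 1 * Suc m, 1]" "\<Theta>2 @ \<Theta>3 @ \<Theta>4"]
          block_architecture[of m "2 * m" m \<delta> A1 b1 "f1 m"] by (simp add: bl hidden_widths_def \<Theta>_def)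
    qed
    have size: "net_size \<Theta> \<le> 68 * m\<^sup>2"
    proof -
      have "net_size \<Theta> \<le> (2 * m * m + 2 * (2 * m) + 3 * (2 * m * Suc m)) + ((2 * m * (2 * m) + 2 * (2 * m) + 3 * (2 * m * Suc m))
         + ((2 * (2 * m) + 2 * 2 + 3 * (2 * Suc m)) + (1 * 2 + 2 * 1 + 3 * (1 * Suc m))))"
        unfolding \<Theta>_def net_size_append bl by (intro add_mono block_size)
      also have "\<dots> = 18 * m\<^sup>2 + 33 * m + 17" by (simp add: power2_eq_square algebra_simps)
      also have "\<dots> \<le> 68 * m\<^sup>2"
      proof -
        have "m \<le> m\<^sup>2" "1 \<le> m\<^sup>2" using m by (auto simp: power2_eq_square)
        then show ?thesis by simp
      qed
      finally show ?thesis .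
    qed
    have "\<bar>vec_index (relu_net \<Theta> U) 0 -
            (\<Sum>j<m. p j * (vec_index U j * exp (- (\<Sum>k<m. a j k * vec_index U k)))) /
            (\<Sum>j<m. p j * exp (- (\<Sum>k<m. a j k * vec_index U k)))\<bar> \<le> E4 / real m"
      if U: "U \<in> carrier_vec m" and UM: "\<And>j. j < m \<Longrightarrow> \<bar>vec_index U j\<bar> \<le> M0"
        and UK: "\<And>j. j < m \<Longrightarrow> \<bar>\<Sum>k<m. a j k * vec_index U k\<bar> \<le> K" for U
    proof -
      define u where "u = (\<lambda>j. vec_index U j)"
      define S where "S = (\<lambda>j. \<Sum>k<m. a j k * u k)"
      have u: "- M0 \<le> u j" "u j \<le> M0" if "j < m" for j using UM[OF that] by (auto simp: u_def)
      have S: "- K \<le> S j" "S j \<le> K" if "j < m" for j using UK[OF that] by (auto simp: u_def S_def)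
      define \<rho> where "\<rho> = (\<lambda>j. (u j + 2 * M0) / M0)"
      have \<rho>: "1 \<le> \<rho> j" "\<rho> j \<le> 3" if "j < m" for j using u[OF that] M0 by (auto simp: \<rho>_def field_simps)
      have ln\<rho>: "0 \<le> ln (\<rho> j)" "ln (\<rho> j) \<le> 2" if "j < m" for j
        using \<rho>[OF that] ln3 order_trans[OF ln_le_cancel_iff[THEN iffD2, of "\<rho> j" 3]] by auto
      \<comment> \<open>\<open>Y1\<close> to \<open>Y3\<close> are the exact values that the outputs \<open>z1\<close> to \<open>z3\<close> of the first three blocks
        approximate; \<open>y\<close> is in each case the exact argument of the scalar function.\<close>
      define z1 where "z1 = map_vec relu (relu_net \<Theta>1 U)"
      define Y1 where "Y1 = (\<lambda>i. if i < m then ln (\<rho> i) else S (i - m) + K)"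
      have z1c: "z1 \<in> carrier_vec (2 * m)" using block_eval(1)[OF U, of 0 "2 * m"] m by (simp add: z1_def bl)
      have z1: "\<bar>vec_index z1 i - Y1 i\<bar> \<le> E1 / real m" if i: "i < 2 * m" for i
      proof -
        define y where "y = (\<Sum>k<m. A1 i k * u k) + b1 i"
        have yv: "y = (if i < m then u i + 2 * M0 else S (i - m) + K)"
        proof (cases "i < m")
          case True
          then have "(\<Sum>k<m. A1 i k * u k) = (\<Sum>k<m. if k = i then u k else 0)"
            by (intro sum.cong) (auto simp: A1_def)
          then show ?thesis using True by (simp add: y_def b1_def)
        qed (simp add: y_def A1_def b1_def S_def)
        have im: "i - m < m" if "\<not> i < m" using i that by auto
        have yB: "y \<in> {0..B}"
          using u[of i] S[of "i - m"] im M0 Bge unfolding yv by (cases "i < m") auto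
        have fy: "f1 m i y = Y1 i" 
        proof (cases "i < m")
          case True
          then have "max M0 (u i + 2 * M0) = u i + 2 * M0" "0 < u i + 2 * M0" using u[of i] M0 by auto
          then show ?thesis using True M0 by (simp add: f1_def yv Y1_def \<rho>_def ln_div)
        qed (simp add: f1_def yv Y1_def)
        have "\<bar>vec_index (relu_net \<Theta>1 U) i - f1 m i y\<bar> \<le> L * ((\<Sum>k<m. \<bar>A1 i k\<bar>) * 0) + 2 * L * B / real m"
          unfolding bl \<delta>_def by (rule block_step[where Y = u]) (use U i m B L(6) lip1 yB in \<open>auto simp: u_def y_def\<close>)
        then have "\<bar>vec_index (relu_net \<Theta>1 U) i - Y1 i\<bar> \<le> E1 / real m" by (simp add: fy E1_def)
        moreover have "Y1 i \<ge> 0" using ln\<rho>[of i] S[of "i - m"] im by (cases "i < m") (auto simp: Y1_def)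
        ultimately show ?thesis using i z1c by (auto simp: z1_def intro!: relu_near)
      qed
      define z2 where "z2 = map_vec relu (relu_net \<Theta>2 z1)"
      define Y2 where "Y2 = (\<lambda>i. if i < m then \<rho> i * exp (- S i) else exp (- S (i - m)))"
      have z2c: "z2 \<in> carrier_vec (2 * m)" using block_eval(1)[OF z1c, of 0 "2 * m"] m by (simp add: z2_def bl)
      have z2: "\<bar>vec_index z2 i - Y2 i\<bar> \<le> E2 / real m" if i: "i < 2 * m" for i
      proof -
        define y where "y = (\<Sum>k<2 * m. A2 i k * Y1 k) + b2 i"
        have yv: "y = (if i < m then ln (\<rho> i) - S i + K else K - S (i - m))"
        proof (cases "i < m")
          case True
          then have "(\<Sum>k<2 * m. A2 i k * Y1 k) = (\<Sum>k<2 * m. (if k = i then Y1 k else 0) - (if k = m + i then Y1 k else 0))"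
            by (intro sum.cong) (auto simp: A2_def)
          also have "\<dots> = Y1 i - Y1 (m + i)" using True by (simp add: sum_subtractf)
          finally show ?thesis using True by (simp add: y_def b2_def Y1_def)
        next
          case False
          then have "(\<Sum>k<2 * m. A2 i k * Y1 k) = (\<Sum>k<2 * m. if k = i then - Y1 k else 0)"
            by (intro sum.cong) (auto simp: A2_def)
          also have "\<dots> = - Y1 i" using i by simp
          finally show ?thesis using False by (simp add: y_def b2_def Y1_def)
        qed
        have im: "i - m < m" if "\<not> i < m" using i that by auto
        have yB: "y \<in> {0..B}"
          using ln\<rho>[of i] S[of i] S[of "i - m"] im Bge unfolding yv by (cases "i < m") auto
        have fy: "f2 i y = Y2 i" using \<rho>[of i] by (auto simp: f2_def yv Y2_def exp_add exp_diff exp_minus field_simps)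
        have "(\<Sum>k<2 * m. \<bar>A2 i k\<bar>) \<le> (\<Sum>k<2 * m. (if k = i then 1 else 0) + (if k = m + i then 1 else 0))"
          by (intro sum_mono) (auto simp: A2_def)
        also have "\<dots> \<le> 2" by (simp add: sum.distrib)
        finally have row: "(\<Sum>k<2 * m. \<bar>A2 i k\<bar>) \<le> 2" .
        have "\<bar>vec_index (relu_net \<Theta>2 z1) i - f2 i y\<bar> \<le> L * (2 * (E1 / real m)) + 2 * L * B / real m"
          unfolding bl \<delta>_def by (rule block_step[where f = f2 and A = A2 and b = b2 and i = i and Y = Y1, OF z1c i m B L(6) lip2 z1 _ row]) (use E yB in \<open>auto simp: y_def\<close>)
        then have "\<bar>vec_index (relu_net \<Theta>2 z1) i - Y2 i\<bar> \<le> E2 / real m" by (simp add: fy E2_def add_divide_distrib)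
        moreover have "Y2 i \<ge> 0" using \<rho>[of i] by (auto simp: Y2_def)
        ultimately show ?thesis using i z2c by (auto simp: z2_def intro!: relu_near)
      qed
      define N D where "N = (\<Sum>j<m. p j * (\<rho> j * exp (- S j)))" and "D = (\<Sum>j<m. p j * exp (- S j))"
      have avg: "lo \<le> (\<Sum>j<m. p j * g j)" "(\<Sum>j<m. p j * g j) \<le> hi" if "\<And>j. j < m \<Longrightarrow> lo \<le> g j" "\<And>j. j < m \<Longrightarrow> g j \<le> hi" for g lo hi
      proof -
        have "(\<Sum>j<m. p j * lo) \<le> (\<Sum>j<m. p j * g j)" "(\<Sum>j<m. p j * g j) \<le> (\<Sum>j<m. p j * hi)"
          using p that by (auto intro!: sum_mono mult_left_mono)
        then show "lo \<le> (\<Sum>j<m. p j * g j)" "(\<Sum>j<m. p j * g j) \<le> hi" by (simp_all add: p1 flip: sum_distrib_right)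
      qed
      have D: "exp (- K) \<le> D" "D \<le> exp K" 
        unfolding D_def using avg[of "exp (- K)" "\<lambda>j. exp (- S j)" "exp K"] S by force+
      have ND: "D \<le> N" "N \<le> 3 * D"
      proof -
        show "D \<le> N" unfolding D_def N_def using \<rho> p by (intro sum_mono mult_left_mono) auto
        have "N \<le> (\<Sum>j<m. p j * (3 * exp (- S j)))"
          unfolding N_def using \<rho> p by (intro sum_mono mult_left_mono mult_right_mono) auto
        then show "N \<le> 3 * D" by (simp add: D_def sum_distrib_left mult.left_commute)
      qed
      have pos: "0 < D" "0 < N" using D ND less_le_trans[OF exp_gt_zero D(1)] by auto
      define z3 where "z3 = map_vec relu (relu_net \<Theta>3 z2)"
      define Y3 where "Y3 = (\<lambda>i. if i = (0::nat) then ln N + K else ln D + K)"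
      have z3c: "z3 \<in> carrier_vec 2" using block_eval(1)[OF z2c, of 0 2] by (simp add: z3_def bl)
      have z3: "\<bar>vec_index z3 i - Y3 i\<bar> \<le> E3 / real m" if i: "i < 2" for i
      proof -
        define y where "y = (if i = 0 then N else D)"
        have yv: "(\<Sum>k<2 * m. A3 i k * Y2 k) + 0 = y"
          unfolding mult_2 sum_lessThan_add by (simp add: A3_def Y2_def y_def N_def D_def)
        have yB: "y \<in> {0..B}"
          using D ND pos Bge unfolding y_def by auto
        have "exp (- K) \<le> y" using D ND by (auto simp: y_def)
        then have fy: "f3 i y = Y3 i" by (simp add: f3_def y_def Y3_def max_def)
        have "(\<Sum>k<m. \<bar>p k\<bar>) = 1" using p p1 by (simp add: abs_of_nonneg)
        then have row: "(\<Sum>k<2 * m. \<bar>A3 i k\<bar>) \<le> 1"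
          unfolding mult_2 sum_lessThan_add by (cases "i = 0") (simp_all add: A3_def)
        have "\<bar>vec_index (relu_net \<Theta>3 z2) i - f3 i y\<bar> \<le> L * (1 * (E2 / real m)) + 2 * L * B / real m"
          unfolding bl \<delta>_def by (rule block_step[where f = f3 and A = A3 and b = "\<lambda>_. 0" and i = i and Y = Y2, OF z2c i m B L(6) lip3 z2 _ row yv yB]) (use E in auto)
        then have "\<bar>vec_index (relu_net \<Theta>3 z2) i - Y3 i\<bar> \<le> E3 / real m" by (simp add: fy E3_def add_divide_distrib)
        moreover have "ln (exp (- K)) \<le> ln y" using \<open>exp (- K) \<le> y\<close> by (subst ln_le_cancel_iff) (auto intro: less_le_trans[OF exp_gt_zero])
        then have "Y3 i \<ge> 0" by (auto simp: Y3_def y_def split: if_splits)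
        ultimately show ?thesis using i z3c by (auto simp: z3_def intro!: relu_near)
      qed
      have "\<bar>vec_index (relu_net \<Theta>4 z3) 0 - f4 0 (ln N - ln D)\<bar> \<le> L * (2 * (E3 / real m)) + 2 * L * B / real m"
        unfolding bl \<delta>_def
      proof (rule block_step[where f = f4 and A = A4 and b = "\<lambda>_. 0" and i = 0 and Y = Y3, OF z3c _ m B L(6) lip4 z3])
        have "ln N \<le> ln (3 * D)" using ND pos by simp
        also have "\<dots> = ln 3 + ln D" using pos by (simp add: ln_mult)
        finally show "ln N - ln D \<in> {0..B}" using ND pos ln3 Bge by auto
      qed (use E in \<open>auto simp: A4_def Y3_def numeral_2_eq_2\<close>)
      moreover have "f4 0 (ln N - ln D) = (\<Sum>j<m. p j * (u j * exp (- S j))) / D"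
      proof -
        have "M0 * N = (\<Sum>j<m. p j * (u j * exp (- S j)) + 2 * M0 * (p j * exp (- S j)))"
          unfolding N_def sum_distrib_left using M0 by (intro sum.cong) (auto simp: \<rho>_def field_simps)
        also have "\<dots> = (\<Sum>j<m. p j * (u j * exp (- S j))) + 2 * M0 * D"
          by (simp add: sum.distrib D_def sum_distrib_left)
        finally show ?thesis using pos by (simp add: f4_def exp_diff field_simps)
      qed
      moreover have "relu_net \<Theta> U = relu_net \<Theta>4 z3"
        using ne by (simp add: \<Theta>_def relu_net_append z1_def z2_def z3_def)
      ultimately show ?thesis by (simp add: u_def S_def D_def E4_def add_divide_distrib)
    qed
    then show "\<exists>\<Theta>. has_architecture (m # hidden_widths m @ [1]) \<Theta> \<and> net_size \<Theta> \<le> 68 * m\<^sup>2 \<and>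
        (\<forall>U\<in>carrier_vec m. (\<forall>j<m. \<bar>vec_index U j\<bar> \<le> M0) \<longrightarrow> (\<forall>j<m. \<bar>\<Sum>k<m. a j k * vec_index U k\<bar> \<le> K) \<longrightarrow>
          \<bar>vec_index (relu_net \<Theta> U) 0 -
            (\<Sum>j<m. p j * (vec_index U j * exp (- (\<Sum>k<m. a j k * vec_index U k)))) /
            (\<Sum>j<m. p j * exp (- (\<Sum>k<m. a j k * vec_index U k)))\<bar> \<le> E4 / real m)"
      using arch size by blast
  qed
qed

section \<open>Solution, discretisation and network error\<close>

text \<open>From \<open>a / b - a' / b' = ((a - a') + (a / b) * (b' - b)) / b'\<close>, where a priori control is used only for the
  first of the two quotients.\<close>

lemma quotient_error:
  fixes a b a' b' :: real
  assumes c: "c > 0" "c \<le> b" "c \<le> b'" and a: "\<bar>a\<bar> \<le> A"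
    and d: "\<bar>a - a'\<bar> \<le> \<epsilon>" "\<bar>b - b'\<bar> \<le> \<epsilon>'"
  shows "\<bar>a / b - a' / b'\<bar> \<le> (\<epsilon> + A / c * \<epsilon>') / c"
proof -
  have b: "b > 0" "b' > 0" using c by auto
  have "a / b - a' / b' = ((a - a') + (a / b) * (b' - b)) / b'" using b by (simp add: field_simps)
  moreover have "\<bar>(a - a') + (a / b) * (b' - b)\<bar> \<le> \<epsilon> + A / c * \<epsilon>'"
  proof (rule order_trans[OF abs_triangle_ineq], rule add_mono[OF d(1)])
    have "\<bar>a\<bar> / b \<le> A / c" using c a b by (intro frac_le) auto
    moreover have "0 \<le> A / c" using a c by auto
    ultimately show "\<bar>a / b * (b' - b)\<bar> \<le> A / c * \<epsilon>'"
      unfolding abs_mult using d(2) b by (intro mult_mono) (auto simp: abs_divide abs_minus_commute)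
  qed
  ultimately show ?thesis using b c by (auto simp: abs_divide intro!: frac_le)
qed

context burgers_data
begin

lemma burgers_op_heat: "burgers_op \<kappa> u0 y t = - 2 * \<kappa> * heat_average_deriv \<kappa> v y t / heat_average \<kappa> v y t"
  by (simp add: burgers_op_def heat_average_def heat_average_deriv_def)

text \<open>The solution becomes an average of \<open>u0\<close> with weight \<open>v\<close>, free of differentiated kernels.\<close>

lemma heat_deriv_v:
  assumes t: "t > 0"
  shows "heat_average_deriv \<kappa> v y t = - (1 / (2 * \<kappa>)) * heat_average \<kappa> (\<lambda>y. u0 y * v y) y t"
proof -
  have bd: "bounded_data (\<lambda>y. - (1 / (2 * \<kappa>)) * (u0 y * v y)) (M0 * Cv / (2 * \<kappa>))"
    using uv_bound \<kappa> by unfold_locales (auto simp: abs_mult intro!: divide_right_mono)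
  show ?thesis
    using v.heat_average_deriv_by_parts[OF \<kappa> t bd v_deriv, of y]
    unfolding heat_average_def by (simp add: mult.left_commute)
qed

lemma burgers_op_average:
  assumes t: "t > 0"
  shows "burgers_op \<kappa> u0 y t = heat_average \<kappa> (\<lambda>y. u0 y * v y) y t / heat_average \<kappa> v y t"
  using \<kappa> by (simp add: burgers_op_heat heat_deriv_v[OF t])

lemma gauss_moment_pos: "s > 0 \<Longrightarrow> gauss_moment 0 v y s > 0"
proof -
  assume s: "s > 0"
  define t where "t = 1 / (4 * \<kappa> * s)"
  have t: "t > 0" "1 / (4 * \<kappa> * t) = s" using s \<kappa> by (auto simp: t_def)
  have "cv \<le> heat_average \<kappa> v y t" by (rule v.heat_average_lower[OF \<kappa> t(1) v_bounds(1)])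
  then have "0 < heat_average \<kappa> v y t" using cv by simp
  moreover define r where "r = sqrt (4 * pi * \<kappa> * t)"
  moreover have "r > 0" using t \<kappa> by (simp add: r_def)
  ultimately show ?thesis using v.heat_average_gauss_moment[OF \<kappa> t(1), of y] t(2) by (simp add: zero_less_divide_iff)
qed

lemma burgers_op_gauss_moment:
  assumes t: "t > 0"
  shows "burgers_op \<kappa> u0 y t = gauss_moment 1 v y (1 / (4 * \<kappa> * t)) / (t * gauss_moment 0 v y (1 / (4 * \<kappa> * t)))"
proof -
  define r where "r = sqrt (4 * pi * \<kappa> * t)"
  have "r > 0" using t \<kappa> by (simp add: r_def)
  then show ?thesis
    unfolding burgers_op_heat v.heat_average_gauss_moment[OF \<kappa> t] v.heat_average_deriv_gauss_moment[OF \<kappa> t] r_def[symmetric]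
    using \<kappa> t by (simp add: field_simps)
qed

lemma burgers_op_periodic: "burgers_op \<kappa> u0 (y - pi) t = burgers_op \<kappa> u0 (y + pi) t" if t: "t > 0"
proof -
  have "heat_average \<kappa> w (y - pi) t = heat_average \<kappa> w (y + pi) t" if w: "\<And>y. w (y + 2 * pi) = w y" for w
  proof -
    have "w (y + pi + z) = w (y - pi + z)" for z using w[of "y - pi + z"] by (simp add: algebra_simps)
    then show ?thesis by (simp add: heat_average_substitution[OF \<kappa> t])
  qed
  then show ?thesis unfolding burgers_op_average[OF t] by (simp add: u0_periodic v_periodic)
qed

lemma burgers_op_initial:
  "((\<lambda>(y, t). burgers_op \<kappa> u0 y t) \<longlongrightarrow> u0 y) (at (y, 0) within UNIV \<times> {0<..})"
proof -
  have "((\<lambda>z. heat_average \<kappa> (\<lambda>y. u0 y * v y) (fst z) (snd z) / heat_average \<kappa> v (fst z) (snd z)) \<longlongrightarrow> u0 y * v y / v y)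
     (at (y, 0) within UNIV \<times> {0<..})"
    using v_bounds(3)[of y]
    by (intro tendsto_divide uv.heat_average_initial v.heat_average_initial \<kappa> continuous_intros u0_continuous v_continuous) simp
  moreover have "\<forall>\<^sub>F z in at (y, 0::real) within UNIV \<times> {0<..}.
      heat_average \<kappa> (\<lambda>y. u0 y * v y) (fst z) (snd z) / heat_average \<kappa> v (fst z) (snd z) = (\<lambda>(y, t). burgers_op \<kappa> u0 y t) z"
    by (auto simp: eventually_at burgers_op_average intro!: exI[of _ 1])
  ultimately show ?thesis using tendsto_cong v_bounds(3)[of y] by fastforce
qed

lemma burgers_solution: "burgers_solution \<kappa> u0 (burgers_op \<kappa> u0)"
proof -
  define u where "u = (\<lambda>y t. gauss_moment 1 v y (1 / (4 * \<kappa> * t)) / (t * gauss_moment 0 v y (1 / (4 * \<kappa> * t))))"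
  have eq: "burgers_op \<kappa> u0 y t = u y t" if "t > 0" for y t
    unfolding u_def by (rule burgers_op_gauss_moment[OF that])
  obtain ut ux uxx where *: 
        "continuous_on (UNIV \<times> {0<..}) (\<lambda>(x, t). ut x t)"
        "continuous_on (UNIV \<times> {0<..}) (\<lambda>(x, t). ux x t)"
        "continuous_on (UNIV \<times> {0<..}) (\<lambda>(x, t). uxx x t)"
        and d: "\<And>y t. t > 0 \<Longrightarrow> ((\<lambda>s. u y s) has_real_derivative ut y t) (at t)"
           "\<And>y t. t > 0 \<Longrightarrow> ((\<lambda>y. u y t) has_real_derivative ux y t) (at y)"
           "\<And>y t. t > 0 \<Longrightarrow> ((\<lambda>y. ux y t) has_real_derivative uxx y t) (at y)"
           "\<And>y t. t > 0 \<Longrightarrow> ut y t + u y t * ux y t = \<kappa> * uxx y t"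
    using v.cole_hopf_burgers[OF \<kappa> gauss_moment_pos] unfolding u_def by blast
  have dt: "((\<lambda>s. burgers_op \<kappa> u0 y s) has_real_derivative ut y t) (at t)" if "t > 0" for y t
    by (rule has_field_derivative_transform_within_open[OF d(1)[OF that], where S = "{0<..}"])
      (use that eq in auto)
  have dx: "((\<lambda>y. burgers_op \<kappa> u0 y t) has_real_derivative ux y t) (at y)" if "t > 0" for y t
    using d(2)[OF that] eq[OF that] by simp
  show ?thesis
    unfolding burgers_solution_def
    using * dt dx d(3,4) eq burgers_op_periodic burgers_op_initial
    by (intro conjI exI[of _ ut] exI[of _ ux] exI[of _ uxx]) auto
qed

text \<open>The common error constant of the two comparisons of the solution with a quotient over
  \<open>heat_average \<kappa> (interp0 m x v)\<close>.\<close>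

definition C1 where "C1 = (W + M0 * Cv / cv * L1) / cv"

lemma interp0_bounds: "bounded_data (interp0 m x v) Cv" "cv \<le> interp0 m x v y" "bounded_data (interp0 m x (\<lambda>y. u0 y * v y)) (M0 * Cv)"
  using v_bounds uv_bound v.bounded by (auto simp: bounded_data_def) (auto simp: interp0_def)

lemma heat_average_close:
  assumes t: "t > 0" and f: "bounded_data f A" and g: "bounded_data g A'" and close: "\<And>y. \<bar>f y - g y\<bar> \<le> \<epsilon>"
  shows "\<bar>heat_average \<kappa> f y t - heat_average \<kappa> g y t\<bar> \<le> \<epsilon>"
proof -
  have "bounded_data (\<lambda>y. f y - g y) \<epsilon>" using f g close by (auto simp: bounded_data_def)
  from bounded_data.heat_average_upper[OF this \<kappa> t, of y]
  show ?thesis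
    unfolding heat_average_def right_diff_distrib
    using bounded_data.integrable_heat[OF f \<kappa> t, of y] bounded_data.integrable_heat[OF g \<kappa> t, of y] by simp
qed

lemma denominators:
  assumes t: "t > 0"
  shows "cv \<le> heat_average \<kappa> v y t" "cv \<le> heat_average \<kappa> (interp0 m x v) y t"
    "\<bar>heat_average \<kappa> v y t - heat_average \<kappa> (interp0 m x v) y t\<bar> \<le> L1 * h"
proof -
  show "cv \<le> heat_average \<kappa> v y t" by (rule v.heat_average_lower[OF \<kappa> t v_bounds(1)])
  show "cv \<le> heat_average \<kappa> (interp0 m x v) y t"
    by (rule bounded_data.heat_average_lower[OF interp0_bounds(1) \<kappa> t interp0_bounds(2)])
  show "\<bar>heat_average \<kappa> v y t - heat_average \<kappa> (interp0 m x v) y t\<bar> \<le> L1 * h"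
    using L1 by (intro heat_average_close[OF t v.bounded_data_axioms interp0_bounds(1)] interp0_error v_lipschitz) auto
qed

text \<open>The numerators differ by the differentiated average of \<open>v - interp1 m x v\<close>, whose Lipschitz constant is
  proportional to \<open>h\<close>; the denominators differ by an average of a function of size \<open>L1 * h\<close>.\<close>

lemma burgers_op_approx_error:
  assumes t: "t > 0"
  shows "\<bar>burgers_op \<kappa> u0 y t - burgers_op_approx \<kappa> m x (nodal_values m x u0) y t\<bar> \<le> C1 * h"
proof -
  define d where "d = (\<lambda>y. v y - interp1 m x v y)"
  define Ld where "Ld = W / (2 * \<kappa>) * h"
  have Ld: "Ld \<ge> 0" using W \<kappa> h_pos by (simp add: Ld_def)
  have lip: "\<bar>d a - d b\<bar> \<le> Ld * \<bar>a - b\<bar>" for a b unfolding d_def Ld_def by (rule interp1_error)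
  have i1m: "interp1 m x v \<in> borel_measurable borel" unfolding interp1_def by (rule pl_function_measurable)
  have d: "bounded_data d (Ld * h)"
  proof
    show "d \<in> borel_measurable borel" unfolding d_def using i1m by measurable
    fix y
    have "d (e (cell m x y)) = 0"
      using pl_function_closed_cell[of "cell m x y" "e (cell m x y)"] e_less_Suc[of "cell m x y"]
      by (simp add: d_def interp1_def)
    then have "\<bar>d y\<bar> \<le> Ld * \<bar>y - e (cell m x y)\<bar>" using lip[of y "e (cell m x y)"] by simp
    also have "\<dots> \<le> Ld * h" using cell_bounds[of y] e_step[of "cell m x y"] Ld by (intro mult_left_mono) auto
    finally show "\<bar>d y\<bar> \<le> Ld * h" .
  qed
  have i1: "bounded_data (interp1 m x v) (Cv + Ld * h)"
  proof
    fix y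
    show "\<bar>interp1 m x v y\<bar> \<le> Cv + Ld * h"
      using v.bounded[of y] bounded_data.bounded[OF d, of y] unfolding d_def by linarith
  qed (rule i1m)
  have diff: "heat_average_deriv \<kappa> v y t - heat_average_deriv \<kappa> (interp1 m x v) y t = heat_average_deriv \<kappa> d y t"
    unfolding heat_average_deriv_def d_def right_diff_distrib
    using v.integrable_heat_deriv[OF \<kappa> t, of y] bounded_data.integrable_heat_deriv[OF i1 \<kappa> t, of y] by simp
  have "\<bar>heat_average_deriv \<kappa> d y t\<bar> \<le> Ld" by (rule bounded_data.heat_average_deriv_lipschitz[OF d \<kappa> t lip])
  then have "2 * \<kappa> * \<bar>heat_average_deriv \<kappa> v y t - heat_average_deriv \<kappa> (interp1 m x v) y t\<bar> \<le> 2 * \<kappa> * Ld"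
    unfolding diff using \<kappa> by (intro mult_left_mono) auto
  then have num: "\<bar>- 2 * \<kappa> * heat_average_deriv \<kappa> v y t - - 2 * \<kappa> * heat_average_deriv \<kappa> (interp1 m x v) y t\<bar> \<le> W * h"
    using \<kappa> by (simp add: Ld_def abs_mult abs_minus_commute flip: right_diff_distrib)
  have A: "\<bar>- 2 * \<kappa> * heat_average_deriv \<kappa> v y t\<bar> \<le> M0 * Cv"
    using uv.heat_average_upper[OF \<kappa> t, of y] \<kappa> by (simp add: heat_deriv_v[OF t])
  have "burgers_op_approx \<kappa> m x (nodal_values m x u0) y t =
     - 2 * \<kappa> * heat_average_deriv \<kappa> (interp1 m x v) y t / heat_average \<kappa> (interp0 m x v) y t"
    by (simp add: burgers_op_approx_def Let_def u0_from[symmetric] heat_average_def heat_average_deriv_def)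
  then have "\<bar>burgers_op \<kappa> u0 y t - burgers_op_approx \<kappa> m x (nodal_values m x u0) y t\<bar> \<le> (W * h + M0 * Cv / cv * (L1 * h)) / cv"
    unfolding burgers_op_heat using quotient_error[OF cv denominators(1,2)[OF t] A num denominators(3)[OF t]] by simp
  also have "\<dots> = C1 * h" by (simp add: C1_def algebra_simps add_divide_distrib)
  finally show ?thesis .
qed

text \<open>The target of the network: the weights are independent of the data, and the remaining expressions
  involve the data through the nodal values of \<open>u0\<close> and \<open>v\<close> alone.\<close>

lemma burgers_op_interp0_error:
  assumes t: "t > 0"
  shows "\<bar>burgers_op \<kappa> u0 y t - (\<Sum>j<m. cell_weight \<kappa> y t j * (u0 (x j) * v (x j))) / (\<Sum>j<m. cell_weight \<kappa> y t j * v (x j))\<bar> \<le> C1 * h"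
proof -
  have num: "\<bar>heat_average \<kappa> (\<lambda>y. u0 y * v y) y t - heat_average \<kappa> (interp0 m x (\<lambda>y. u0 y * v y)) y t\<bar> \<le> W * h"
    using W by (intro heat_average_close[OF t uv.bounded_data_axioms interp0_bounds(3)] interp0_error uv_lipschitz) auto
  have "\<bar>burgers_op \<kappa> u0 y t - heat_average \<kappa> (interp0 m x (\<lambda>y. u0 y * v y)) y t / heat_average \<kappa> (interp0 m x v) y t\<bar>
     \<le> (W * h + M0 * Cv / cv * (L1 * h)) / cv"
    unfolding burgers_op_average[OF t]
    by (rule quotient_error[OF cv denominators(1,2)[OF t] uv.heat_average_upper[OF \<kappa> t] num denominators(3)[OF t]])
  also have "\<dots> = C1 * h" by (simp add: C1_def algebra_simps add_divide_distrib)
  finally show ?thesis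
    using heat_average_interp0[OF \<kappa> t, of v y] heat_average_interp0[OF \<kappa> t, of "\<lambda>y. u0 y * v y" y]
    by (simp add: v_periodic u0_periodic)
qed

text \<open>The exponent of \<open>v\<close> at a node is a linear function of the nodal values, with coefficients given by
  integrals of the hat functions.\<close>

lemma Q_node:
  assumes "j < m"
  shows "Q (x j) / (2 * \<kappa>) = (\<Sum>k<m. (LINT s:{- pi..x j}|lborel. hat m x k s) / (2 * \<kappa>) * vec_index (nodal_values m x u0) k)"
proof -
  have "- pi \<le> x j" using e_mono[of 0 "int j"] e_nat[OF assms] e_nat[of 0] m_pos x_first by simp
  then have "Q (x j) = (LINT s:{- pi..x j}|lborel. u0 s)" by (simp add: Q_integral)
  also have "\<dots> = (LINT s:{- pi..x j}|lborel. \<Sum>k<m. vec_index (nodal_values m x u0) k * hat m x k s)"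
    using u0_from by (metis from_nodal_values_def)
  also have "\<dots> = (\<Sum>k<m. LINT s:{- pi..x j}|lborel. vec_index (nodal_values m x u0) k * hat m x k s)"
    unfolding set_lebesgue_integral_def scaleR_sum_right
  proof (rule Bochner_Integration.integral_sum)
    fix k
    have "integrable lborel (\<lambda>s. indicator {- pi..x j} s *\<^sub>R hat m x k s)"
    proof (rule integrableI_bounded_set_indicator[where B = 2])
      show "hat m x k \<in> borel_measurable lborel" unfolding hat_def using pl_function_measurable by simp
      show "AE s in lborel. s \<in> {- pi..x j} \<longrightarrow> norm (hat m x k s) \<le> 2" using hat_bounded by simp
    qed (auto simp: emeasure_lborel_Icc_eq)
    then have "integrable lborel (\<lambda>s. vec_index (nodal_values m x u0) k * (indicator {- pi..x j} s *\<^sub>R hat m x k s))"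
      by (rule integrable_mult_right)
    then show "integrable lborel (\<lambda>s. indicator {- pi..x j} s *\<^sub>R (vec_index (nodal_values m x u0) k * hat m x k s))"
      by (simp add: mult_ac)
  qed
  finally show ?thesis using \<kappa> by (simp add: sum_divide_distrib mult_ac)
qed

end

theorem theorem4p3:
  fixes \<kappa> M0 M1 :: real
  assumes "\<kappa> > 0" and "M0 > 0" and "M1 > 0"
  shows "\<exists>(C::real) (N :: nat \<Rightarrow> nat).
    (\<lambda>m. real (N m)) \<in> O(\<lambda>m. (real m)\<^sup>2 * ln (real m)) \<and>
    (\<forall>m msh h. is_mesh m msh h \<longrightarrow>
      (\<forall>u0 \<in> pl_data M0 M1 m msh. burgers_solution \<kappa> u0 (burgers_op \<kappa> u0)) \<and>
      (\<exists>hidden :: nat list.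
        \<forall>x \<in> {-pi..<pi}. \<forall>t \<in> {0<..}.
          \<exists>\<Theta>. has_architecture (m # hidden @ [1]) \<Theta> \<and> net_size \<Theta> \<le> N m \<and>
            (\<forall>u0 \<in> pl_data M0 M1 m msh.
              let G = burgers_op \<kappa> u0 x t;
                  Gm = burgers_op_approx \<kappa> m msh (nodal_values m msh u0) x t;
                  g = vec_index (relu_net \<Theta> (nodal_values m msh u0)) 0
              in \<bar>G - g\<bar> \<le> \<bar>G - Gm\<bar> + \<bar>Gm - g\<bar> \<and>
                 \<bar>G - Gm\<bar> + \<bar>Gm - g\<bar> \<le> C * h)))"
proof -
  define K where "K = pi * M0 / \<kappa>"
  have K: "K > 0" using assms by (simp add: K_def)
  obtain C where C: "C \<ge> 0" and net:
    "\<And>m (a :: nat \<Rightarrow> nat \<Rightarrow> real) p. \<lbrakk>m \<ge> 1; \<And>j. j < m \<Longrightarrow> p j \<ge> 0; (\<Sum>j<m. p j) = 1\<rbrakk> \<Longrightarrow>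
      \<exists>\<Theta>. has_architecture (m # hidden_widths m @ [1]) \<Theta> \<and> net_size \<Theta> \<le> 68 * m\<^sup>2 \<and>
        (\<forall>U\<in>carrier_vec m. (\<forall>j<m. \<bar>vec_index U j\<bar> \<le> M0) \<longrightarrow> (\<forall>j<m. \<bar>\<Sum>k<m. a j k * vec_index U k\<bar> \<le> K) \<longrightarrow>
          \<bar>vec_index (relu_net \<Theta> U) 0 -
            (\<Sum>j<m. p j * (vec_index U j * exp (- (\<Sum>k<m. a j k * vec_index U k)))) /
            (\<Sum>j<m. p j * exp (- (\<Sum>k<m. a j k * vec_index U k)))\<bar> \<le> C / real m)"
    using weighted_average_network[OF assms(2) K] by blast
  define E where "E = burgers_data.C1 \<kappa> M0 M1"
  show ?thesis
  proof (intro exI[of _ "3 * E + C / (2 * pi)"] exI[of _ "\<lambda>m. 68 * m\<^sup>2"] conjI allI impI)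
    show "(\<lambda>m. real (68 * m\<^sup>2)) \<in> O(\<lambda>m. (real m)\<^sup>2 * ln (real m))"
    proof (rule bigoI[where c = 68])
      have "\<forall>\<^sub>F m in sequentially. 3 \<le> m" by (rule eventually_ge_at_top)
      then show "\<forall>\<^sub>F m in sequentially. norm (real (68 * m\<^sup>2)) \<le> 68 * norm ((real m)\<^sup>2 * ln (real m))"
      proof eventually_elim
        case (elim m)
        have "1 \<le> ln (real m)" using elim exp_le by (subst ln_ge_iff) auto
        then have "(real m)\<^sup>2 * 1 \<le> (real m)\<^sup>2 * ln (real m)" by (intro mult_left_mono) auto
        then show ?case using \<open>1 \<le> ln (real m)\<close> by (simp add: abs_mult)
      qed
    qed
  next
    fix m msh h assume mesh: "is_mesh m msh h"
    interpret mesh m msh h by unfold_locales fact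
    have data: "burgers_data m msh h \<kappa> M0 M1 u0" if "u0 \<in> pl_data M0 M1 m msh" for u0
      using that assms by unfold_locales
    show "\<forall>u0 \<in> pl_data M0 M1 m msh. burgers_solution \<kappa> u0 (burgers_op \<kappa> u0)"
      using burgers_data.burgers_solution[OF data] by blast
    show "\<exists>hidden :: nat list.
        \<forall>x \<in> {-pi..<pi}. \<forall>t \<in> {0<..}.
          \<exists>\<Theta>. has_architecture (m # hidden @ [1]) \<Theta> \<and> net_size \<Theta> \<le> 68 * m\<^sup>2 \<and>
            (\<forall>u0 \<in> pl_data M0 M1 m msh.
              let G = burgers_op \<kappa> u0 x t;
                  Gm = burgers_op_approx \<kappa> m msh (nodal_values m msh u0) x t;
                  g = vec_index (relu_net \<Theta> (nodal_values m msh u0)) 0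
              in \<bar>G - g\<bar> \<le> \<bar>G - Gm\<bar> + \<bar>Gm - g\<bar> \<and>
                 \<bar>G - Gm\<bar> + \<bar>Gm - g\<bar> \<le> (3 * E + C / (2 * pi)) * h)"
    proof (intro exI[of _ "hidden_widths m"] ballI)
      fix x t :: real assume "t \<in> {0<..}"
      then have t: "t > 0" by simp
      define p where "p = cell_weight \<kappa> x t"
      define a where "a = (\<lambda>j k. (LINT s:{- pi..msh j}|lborel. hat m msh k s) / (2 * \<kappa>))"
      obtain \<Theta> where \<Theta>: "has_architecture (m # hidden_widths m @ [1]) \<Theta>" "net_size \<Theta> \<le> 68 * m\<^sup>2"
        and approx: "\<And>U. U \<in> carrier_vec m \<Longrightarrow> (\<And>j. j < m \<Longrightarrow> \<bar>vec_index U j\<bar> \<le> M0) \<Longrightarrow> (\<And>j. j < m \<Longrightarrow> \<bar>\<Sum>k<m. a j k * vec_index U k\<bar> \<le> K) \<Longrightarrow>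
          \<bar>vec_index (relu_net \<Theta> U) 0 -
            (\<Sum>j<m. p j * (vec_index U j * exp (- (\<Sum>k<m. a j k * vec_index U k)))) /
            (\<Sum>j<m. p j * exp (- (\<Sum>k<m. a j k * vec_index U k)))\<bar> \<le> C / real m"
        using net[of m p a] m_pos cell_weight_nonneg[OF assms(1) t] sum_cell_weight[OF assms(1) t] unfolding p_def by blast
      have "\<bar>burgers_op \<kappa> u0 x t - burgers_op_approx \<kappa> m msh (nodal_values m msh u0) x t\<bar> +
         \<bar>burgers_op_approx \<kappa> m msh (nodal_values m msh u0) x t - vec_index (relu_net \<Theta> (nodal_values m msh u0)) 0\<bar>
          \<le> (3 * E + C / (2 * pi)) * h" if u0: "u0 \<in> pl_data M0 M1 m msh" for u0
      proof -
        interpret burgers_data m msh h \<kappa> M0 M1 u0 by (rule data[OF u0])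
        define U where "U = nodal_values m msh u0"
        have U: "U \<in> carrier_vec m" "\<And>j. j < m \<Longrightarrow> vec_index U j = u0 (msh j)" by (auto simp: U_def nodal_values_def)
        have S: "(\<Sum>k<m. a j k * vec_index U k) = Q (msh j) / (2 * \<kappa>)" if "j < m" for j
          unfolding a_def U_def by (rule Q_node[OF that, symmetric])
        have V: "exp (- (\<Sum>k<m. a j k * vec_index U k)) = v (msh j)" if "j < m" for j
          unfolding S[OF that] v_eq ..
        have "\<bar>vec_index (relu_net \<Theta> U) 0 -
            (\<Sum>j<m. p j * (vec_index U j * exp (- (\<Sum>k<m. a j k * vec_index U k)))) /
            (\<Sum>j<m. p j * exp (- (\<Sum>k<m. a j k * vec_index U k)))\<bar> \<le> C / real m"
        proof (rule approx[OF U(1)])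
          show "\<bar>vec_index U j\<bar> \<le> M0" if "j < m" for j using U(2)[OF that] u0_bound by simp
          show "\<bar>\<Sum>k<m. a j k * vec_index U k\<bar> \<le> K" if "j < m" for j
            unfolding S[OF that] using Q_bound[of "msh j"] assms(1) by (simp add: K_def abs_divide field_simps)
        qed
        also have "(\<Sum>j<m. p j * (vec_index U j * exp (- (\<Sum>k<m. a j k * vec_index U k)))) = (\<Sum>j<m. p j * (u0 (msh j) * v (msh j)))"
        proof (rule sum.cong[OF refl])
          fix j assume "j \<in> {..<m}"
          then have "j < m" by simp
          then show "p j * (vec_index U j * exp (- (\<Sum>k<m. a j k * vec_index U k))) = p j * (u0 (msh j) * v (msh j))"
            by (simp only: U(2) V)
        qed
        also have "(\<Sum>j<m. p j * exp (- (\<Sum>k<m. a j k * vec_index U k))) = (\<Sum>j<m. p j * v (msh j))"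
          by (intro sum.cong refl) (simp only: lessThan_iff V)
        finally have g: "\<bar>vec_index (relu_net \<Theta> U) 0 - (\<Sum>j<m. p j * (u0 (msh j) * v (msh j))) / (\<Sum>j<m. p j * v (msh j))\<bar> \<le> C / real m" .
        have "C / real m \<le> C / (2 * pi) * h" using mult_left_mono[OF inverse_m_le C] by simp
        with g burgers_op_interp0_error[OF t, of x] burgers_op_approx_error[OF t, of x]
        show ?thesis unfolding U_def[symmetric] p_def[symmetric] E_def by (simp add: distrib_right)
      qed
      then show "\<exists>\<Theta>. has_architecture (m # hidden_widths m @ [1]) \<Theta> \<and> net_size \<Theta> \<le> 68 * m\<^sup>2 \<and>
            (\<forall>u0 \<in> pl_data M0 M1 m msh.
              let G = burgers_op \<kappa> u0 x t;
                  Gm = burgers_op_approx \<kappa> m msh (nodal_values m msh u0) x t;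
                  g = vec_index (relu_net \<Theta> (nodal_values m msh u0)) 0
              in \<bar>G - g\<bar> \<le> \<bar>G - Gm\<bar> + \<bar>Gm - g\<bar> \<and>
                 \<bar>G - Gm\<bar> + \<bar>Gm - g\<bar> \<le> (3 * E + C / (2 * pi)) * h)"
        using \<Theta> by (intro exI[of _ \<Theta>]) (auto simp: Let_def)
    qed
  qed
qed

end
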